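(* Let $\Phi={}^t(\Phi_1,\dots,\Phi_d)$ and $\Omega={}^t(\Omega_1,\dots,\Omega_d)$, with $\Phi_j={}^t(\phi_{j,1},\phi_{j,2})$, $\Omega_j={}^t(\omega_{j,1},\omega_{j,2})\in\mathbb{C}^2$, be unit vectors in $\mathbb{C}^{2d}$ such that (a) $\Phi_j\cdot(\sigma_1\Omega_j)=0$ for all $j\in\{1,\dots,d\}$, and (b) $\langle\Phi_l,\sigma_+\Omega_l\rangle_{\mathbb{C}^2}\neq0$ for some $l\in\{1,\dots,d\}$, which we fix. Let $(\bm p,\bm q)\in D_l$, let $T$ be the discriminant operator on $\ell^2(\mathbb{Z}^d)$, and let $\mathfrak{f}:[-1,1]\setminus\sigma(T_0)\to\mathbb{R}$ be the function $$\mathfrak{f}(\lambda)=\lambda-a_\Omega(\bm p)+\langle\varphi_{\bm q},(T_0-\lambda)^{-1}\varphi_{\bm q}\rangle_{\ell^2(\mathbb{Z}^d)}$$ (see context). If $\mathfrak{f}$ has a zero $\lambda_\star\in[-1,1]\setminus(\sigma(T_0)\cup\{a_\Omega(\bm p)\})$, then $\lambda_\star$ is a discrete eigenvalue of $T$.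
   Context: Inner products $\langle\cdot,\cdot\rangle$ are conjugate-linear in the first argument; ${}^*$ on scalars is complex conjugation. For $\Psi={}^t(\psi_1,\psi_2),\Phi={}^t(\phi_1,\phi_2)\in\mathbb{C}^2$, $\Psi\cdot\Phi=\psi_1\phi_1+\psi_2\phi_2$ (bilinear, no conjugation). Matrices: $\sigma_1=\begin{pmatrix}0&1\\1&0\end{pmatrix}$, $\sigma_+=\begin{pmatrix}0&1\\0&0\end{pmatrix}$, $\sigma_3=\begin{pmatrix}1&0\\0&-1\end{pmatrix}$. $d\ge1$ is an integer; $D=\{(\bm p,\bm q)\in\mathbb{R}^d\times\mathbb{C}^d: p_j^2+|q_j|^2=1,\ j=1,\dots,d\}$ and $D_l=\{(\bm p,\bm q)\in D: p_lq_l\neq0\}$. $\{\bm e_j\}_{j=1}^d$ is the standard basis of $\mathbb{Z}^d$; $\mathbbm{1}_A$ is the characteristic function of $A\subset\mathbb{Z}^d$; $\mathcal{H}=\ell^2(\mathbb{Z}^d;\mathbb{C}^{2d})\simeq\bigoplus_{j=1}^d\ell^2(\mathbb{Z}^d;\mathbb{C}^2)$, $\mathcal{K}=\ell^2(\mathbb{Z}^d)$. Shift: on $\ell^2(\mathbb{Z}^d;\mathbb{C}^2)$, $$(S_j\psi)(\bm x)=\begin{pmatrix}p_j\psi_1(\bm x)+q_j\psi_2(\bm x+\bm e_j)\\ q_j^*\psi_1(\bm x-\bm e_j)-p_j\psi_2(\bm x)\end{pmatrix},\qquad S=S_1\oplus\cdots\oplus S_d\ \text{ on }\mathcal{H}.$$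 Let $\chi(\bm x)=\Phi$ for $\bm x\neq\bm 0$ and $\chi(\bm 0)=\Omega$; define $d_\chi:\mathcal{H}\to\mathcal{K}$ by $(d_\chi\Psi)(\bm x)=\langle\chi(\bm x),\Psi(\bm x)\rangle_{\mathbb{C}^{2d}}$. The discriminant operator is $T=d_\chi Sd_\chi^*$, a bounded self-adjoint operator on $\mathcal{K}$. $a_\Omega(\bm p)=\sum_{j=1}^dp_j\langle\Omega_j,\sigma_3\Omega_j\rangle_{\mathbb{C}^2}$, $a_\Phi(\bm p)=\sum_{j=1}^dp_j\langle\Phi_j,\sigma_3\Phi_j\rangle_{\mathbb{C}^2}$, $\alpha_j=q_j\phi_{j,1}^*\phi_{j,2}$. On $\mathcal{K}$, $(L_jf)(\bm x)=f(\bm x+\bm e_j)$ and $T_0=a_\Phi(\bm p)+\sum_{j=1}^d(\alpha_jL_j+\alpha_j^*L_j^* )$. $\varphi_{\bm q}=\sum_{j=1}^d\bigl(q_j\omega_{j,2}\phi_{j,1}^*\mathbbm{1}_{\{-\bm e_j\}}+q_j^*\omega_{j,1}\phi_{j,2}^*\mathbbm{1}_{\{\bm e_j\}}\bigr)\in\mathcal{K}$. A discrete eigenvalue of a self-adjoint operator is an isolated point of its spectrum that is an eigenvalue of finite multiplicity (equivalently, a point of the spectrum not in the essential spectrum). *)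

theory Defs
  imports "HOL-Analysis.Analysis"
begin

text \<open>
  The complex inner product is conjugate-linear in the first argument. It refines the given real
  inner product, which is its real part, so norm and topology are those of \<^class>\<open>real_inner\<close>.
\<close>

class complex_inner = real_inner +
  fixes scaleC :: "complex \<Rightarrow> 'a \<Rightarrow> 'a"  (infixr \<open>*\<^sub>C\<close> 75)
    and cinner :: "'a \<Rightarrow> 'a \<Rightarrow> complex"
  assumes scaleC_add_right: "a *\<^sub>C (x + y) = a *\<^sub>C x + a *\<^sub>C y"
    and scaleC_add_left: "(a + b) *\<^sub>C x = a *\<^sub>C x + b *\<^sub>C x"
    and scaleC_scaleC: "a *\<^sub>C b *\<^sub>C x = (a * b) *\<^sub>C x"
    and scaleR_scaleC: "r *\<^sub>R x = complex_of_real r *\<^sub>C x"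
    and cinner_commute: "cinner x y = cnj (cinner y x)"
    and cinner_add_right: "cinner x (y + z) = cinner x y + cinner x z"
    and cinner_scaleC_right: "cinner x (a *\<^sub>C y) = a * cinner x y"
    and inner_eq_Re_cinner: "inner x y = Re (cinner x y)"

lemma scaleC_one [simp]: "1 *\<^sub>C x = (x :: 'a :: complex_inner)"
  using scaleR_scaleC[of 1 x] by simp

lemma vector_space_scaleC: "vector_space (scaleC :: complex \<Rightarrow> 'a \<Rightarrow> 'a :: complex_inner)"
  by unfold_locales (simp_all add: scaleC_add_right scaleC_add_left scaleC_scaleC)

lemma cinner_scaleC_left: "cinner (a *\<^sub>C x) y = cnj a * cinner x (y :: 'a :: complex_inner)"
  by (metis cinner_commute cinner_scaleC_right complex_cnj_mult)

lemma cinner_add_left: "cinner (x + y) z = cinner x z + cinner y (z :: 'a :: complex_inner)"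
  by (metis cinner_commute cinner_add_right complex_cnj_add)

lemma cinner_zero_left [simp]: "cinner 0 (x :: 'a :: complex_inner) = 0"
  using cinner_add_left[of 0 0 x] by simp

lemma cinner_zero_right [simp]: "cinner (x :: 'a :: complex_inner) 0 = 0"
  using cinner_add_right[of x 0 0] by simp

lemma cinner_sum_right: "cinner x (sum f A) = (\<Sum>i\<in>A. cinner x (f i :: 'a :: complex_inner))"
  by (induction A rule: infinite_finite_induct) (auto simp: cinner_add_right)

lemma cinner_sum_left: "cinner (sum f A) x = (\<Sum>i\<in>A. cinner (f i :: 'a :: complex_inner) x)"
  by (induction A rule: infinite_finite_induct) (auto simp: cinner_add_left)

lemma cinner_diff_right: "cinner x (y - z) = cinner x y - cinner x (z :: 'a :: complex_inner)"
  using cinner_add_right[of x "y - z" z] by simp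

lemma cinner_diff_left: "cinner (x - y) z = cinner x z - cinner y (z :: 'a :: complex_inner)"
  using cinner_add_left[of "x - y" y z] by simp

lemma norm_scaleC: "norm (a *\<^sub>C x) = cmod a * norm (x :: 'a :: complex_inner)"
proof -
  have "(norm (a *\<^sub>C x))\<^sup>2 = Re ((cnj a * a) * cinner x x)"
    by (simp add: power2_norm_eq_inner inner_eq_Re_cinner cinner_scaleC_right cinner_scaleC_left
        mult.assoc mult.left_commute)
  also have "cnj a * a = complex_of_real ((cmod a)\<^sup>2)"
    by (metis complex_norm_square mult.commute)
  finally have "(norm (a *\<^sub>C x))\<^sup>2 = (cmod a * norm x)\<^sup>2"
    by (simp add: power2_norm_eq_inner inner_eq_Re_cinner power_mult_distrib)
  then show ?thesis
    by (simp add: power2_eq_iff_nonneg)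
qed

lemma norm_cinner_le: "cmod (cinner x y) \<le> 2 * (norm x * norm (y :: 'a :: complex_inner))"
proof -
  have "\<bar>Re (cinner x y)\<bar> \<le> norm x * norm y"
    by (metis Cauchy_Schwarz_ineq2 inner_eq_Re_cinner)
  moreover have "\<bar>Im (cinner x y)\<bar> \<le> norm x * norm y"
    using Cauchy_Schwarz_ineq2[of x "(- \<i>) *\<^sub>C y"]
    by (simp add: inner_eq_Re_cinner cinner_scaleC_right norm_scaleC)
  ultimately show ?thesis
    using cmod_le[of "cinner x y"] by linarith
qed

instantiation complex :: complex_inner
begin
definition scaleC_complex :: "complex \<Rightarrow> complex \<Rightarrow> complex"
  where "scaleC_complex a x = a * x"
definition cinner_complex :: "complex \<Rightarrow> complex \<Rightarrow> complex"
  where "cinner_complex x y = cnj x * y"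
instance
  by standard
    (auto simp: scaleC_complex_def cinner_complex_def algebra_simps scaleR_conv_of_real
      inner_complex_def)
end

instantiation vec :: (complex_inner, finite) complex_inner
begin
definition scaleC_vec :: "complex \<Rightarrow> 'a ^ 'b \<Rightarrow> 'a ^ 'b"
  where "scaleC_vec a x = (\<chi> i. a *\<^sub>C x $ i)"
definition cinner_vec :: "'a ^ 'b \<Rightarrow> 'a ^ 'b \<Rightarrow> complex"
  where "cinner_vec x y = (\<Sum>i\<in>UNIV. cinner (x $ i) (y $ i))"
instance
proof
  show "cinner x y = cnj (cinner y x)" for x y :: "'a ^ 'b"
    unfolding cinner_vec_def cnj_sum by (rule sum.cong) (auto intro: cinner_commute)
qed (auto simp: scaleC_vec_def cinner_vec_def vec_eq_iff scaleC_add_right scaleC_add_left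
      scaleC_scaleC scaleR_scaleC cinner_add_right sum.distrib cinner_scaleC_right sum_distrib_left
      inner_vec_def inner_eq_Re_cinner)
end

definition square_summable :: "('x \<Rightarrow> 'v :: real_normed_vector) \<Rightarrow> bool"
  where "square_summable f \<longleftrightarrow> (\<lambda>x. (norm (f x))\<^sup>2) summable_on UNIV"

lemma square_summable_le:
  assumes "square_summable f" "\<And>x. norm (g x) \<le> C * norm (f x)"
  shows "square_summable g"
  unfolding square_summable_def
proof (rule summable_on_comparison_test)
  show "(\<lambda>x. C\<^sup>2 * (norm (f x))\<^sup>2) summable_on UNIV"
    using assms(1) unfolding square_summable_def by (rule summable_on_cmult_right)
  show "(norm (g x))\<^sup>2 \<le> C\<^sup>2 * (norm (f x))\<^sup>2" for x
    using power_mono[OF assms(2), of x 2] by (simp add: power_mult_distrib)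
qed auto

lemma square_summable_zero: "square_summable (\<lambda>_. 0)"
  by (simp add: square_summable_def)

lemma square_summable_add:
  assumes "square_summable f" "square_summable g"
  shows "square_summable (\<lambda>x. f x + g x)"
  unfolding square_summable_def
proof (rule summable_on_comparison_test)
  show "(\<lambda>x. 2 * (norm (f x))\<^sup>2 + 2 * (norm (g x))\<^sup>2) summable_on UNIV"
    using assms unfolding square_summable_def
    by (intro summable_on_add summable_on_cmult_right)
  show "(norm (f x + g x))\<^sup>2 \<le> 2 * (norm (f x))\<^sup>2 + 2 * (norm (g x))\<^sup>2" for x
  proof -
    have "(norm (f x + g x))\<^sup>2 \<le> (norm (f x) + norm (g x))\<^sup>2"
      by (intro power_mono norm_triangle_ineq) auto
    also have "\<dots> \<le> 2 * (norm (f x))\<^sup>2 + 2 * (norm (g x))\<^sup>2"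
      using zero_le_power2[of "norm (f x) - norm (g x)"] unfolding power2_sum power2_diff
      by linarith
    finally show ?thesis .
  qed
qed auto

lemma square_summable_sum:
  assumes "\<And>i. i \<in> A \<Longrightarrow> square_summable (f i)"
  shows "square_summable (\<lambda>x. \<Sum>i\<in>A. f i x)"
  using assms
  by (induction A rule: infinite_finite_induct)
    (auto intro: square_summable_add square_summable_zero)

lemma square_summable_bij:
  assumes "square_summable f" "bij h"
  shows "square_summable (\<lambda>x. f (h x))"
  using assms summable_on_reindex_bij_betw[of h UNIV UNIV "\<lambda>x. (norm (f x))\<^sup>2"]
  by (simp add: square_summable_def)

lemma square_summable_scaleC:
  "square_summable f \<Longrightarrow> square_summable (\<lambda>x. a *\<^sub>C f x :: 'v :: complex_inner)"
  by (erule square_summable_le[where C = "cmod a"]) (simp add: norm_scaleC)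

lemma square_summable_cinner:
  assumes "square_summable f" "square_summable (g :: 'x \<Rightarrow> 'v :: complex_inner)"
  shows "(\<lambda>x. cinner (f x) (g x)) summable_on UNIV"
proof (rule abs_summable_summable, rule summable_on_comparison_test)
  show "(\<lambda>x. (norm (f x))\<^sup>2 + (norm (g x))\<^sup>2) summable_on UNIV"
    using assms unfolding square_summable_def by (rule summable_on_add)
  show "cmod (cinner (f x) (g x)) \<le> (norm (f x))\<^sup>2 + (norm (g x))\<^sup>2" for x
    using norm_cinner_le[of "f x" "g x"] sum_squares_bound[of "norm (f x)" "norm (g x)"]
    by simp
qed auto

typedef (overloaded) ('x, 'v) ell2 = "{f :: 'x \<Rightarrow> 'v :: complex_inner. square_summable f}"
  morphisms ell2_apply Abs_ell2
  by (auto intro: square_summable_zero)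

setup_lifting type_definition_ell2

lemma square_summable_ell2_apply: "square_summable (ell2_apply f)"
  by transfer

lemma ell2_eqI: "(\<And>x. ell2_apply f x = ell2_apply g x) \<Longrightarrow> f = g"
  by (metis ell2_apply_inject ext)

instantiation ell2 :: (type, complex_inner) complex_inner
begin

lift_definition zero_ell2 :: "('a, 'b) ell2" is "\<lambda>_. 0"
  by (rule square_summable_zero)
lift_definition plus_ell2 :: "('a, 'b) ell2 \<Rightarrow> ('a, 'b) ell2 \<Rightarrow> ('a, 'b) ell2"
  is "\<lambda>f g x. f x + g x" by (rule square_summable_add)
lift_definition uminus_ell2 :: "('a, 'b) ell2 \<Rightarrow> ('a, 'b) ell2" is "\<lambda>f x. - f x"
  by (erule square_summable_le[where C = 1]) simp
definition minus_ell2 :: "('a, 'b) ell2 \<Rightarrow> ('a, 'b) ell2 \<Rightarrow> ('a, 'b) ell2"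
  where "minus_ell2 f g = f + - g"
lift_definition scaleC_ell2 :: "complex \<Rightarrow> ('a, 'b) ell2 \<Rightarrow> ('a, 'b) ell2"
  is "\<lambda>a f x. a *\<^sub>C f x" by (rule square_summable_scaleC)
definition scaleR_ell2 :: "real \<Rightarrow> ('a, 'b) ell2 \<Rightarrow> ('a, 'b) ell2"
  where "scaleR_ell2 r f = complex_of_real r *\<^sub>C f"
lift_definition cinner_ell2 :: "('a, 'b) ell2 \<Rightarrow> ('a, 'b) ell2 \<Rightarrow> complex"
  is "\<lambda>f g. \<Sum>\<^sub>\<infinity>x. cinner (f x) (g x)" .
definition inner_ell2 :: "('a, 'b) ell2 \<Rightarrow> ('a, 'b) ell2 \<Rightarrow> real"
  where "inner_ell2 f g = Re (cinner f g)"
definition norm_ell2 :: "('a, 'b) ell2 \<Rightarrow> real"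
  where "norm_ell2 f = sqrt (inner f f)"
definition sgn_ell2 :: "('a, 'b) ell2 \<Rightarrow> ('a, 'b) ell2"
  where "sgn_ell2 f = inverse (norm f) *\<^sub>R f"
definition dist_ell2 :: "('a, 'b) ell2 \<Rightarrow> ('a, 'b) ell2 \<Rightarrow> real"
  where "dist_ell2 f g = norm (f - g)"
definition uniformity_ell2 :: "(('a, 'b) ell2 \<times> ('a, 'b) ell2) filter"
  where "uniformity_ell2 = (INF e\<in>{0<..}. principal {(x, y). dist x y < e})"
definition open_ell2 :: "('a, 'b) ell2 set \<Rightarrow> bool"
  where "open_ell2 U \<longleftrightarrow> (\<forall>x\<in>U. eventually (\<lambda>(x', y). x' = x \<longrightarrow> y \<in> U) uniformity)"

instance
proof
  fix f g h :: "('a, 'b) ell2" and r s :: real and a b :: complex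
  show "f + g + h = f + (g + h)" "f + g = g + f" "0 + f = f" "- f + f = 0"
    by (transfer; simp add: algebra_simps)+
  show "f - g = f + - g"
    by (rule minus_ell2_def)
  show C1: "a *\<^sub>C (f + g) = a *\<^sub>C f + a *\<^sub>C g"
    and C2: "(a + b) *\<^sub>C f = a *\<^sub>C f + b *\<^sub>C f"
    and C3: "a *\<^sub>C b *\<^sub>C f = (a * b) *\<^sub>C f" for a b :: complex and f g :: "('a, 'b) ell2"
    by (transfer; simp add: scaleC_add_right scaleC_add_left scaleC_scaleC)+
  show "r *\<^sub>R f = complex_of_real r *\<^sub>C f"
    by (rule scaleR_ell2_def)
  show "r *\<^sub>R (f + g) = r *\<^sub>R f + r *\<^sub>R g" "(r + s) *\<^sub>R f = r *\<^sub>R f + s *\<^sub>R f"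
    "r *\<^sub>R s *\<^sub>R f = (r * s) *\<^sub>R f"
    by (simp_all add: scaleR_ell2_def C1 C2 C3)
  show "1 *\<^sub>R f = f"
    unfolding scaleR_ell2_def by transfer simp
  show I1: "cinner f g = cnj (cinner g f)" for f g :: "('a, 'b) ell2"
    by transfer (simp flip: infsum_cnj cinner_commute)
  show I2: "cinner f (g + h) = cinner f g + cinner f h" for f g h :: "('a, 'b) ell2"
    by transfer (simp add: cinner_add_right infsum_add square_summable_cinner)
  show I3: "cinner f (a *\<^sub>C g) = a * cinner f g" for a and f g :: "('a, 'b) ell2"
    by transfer (simp add: cinner_scaleC_right infsum_cmult_right')
  show "inner f g = Re (cinner f g)"
    by (rule inner_ell2_def)
  have I4: "Re (cinner f g) = Re (cinner g f)" for f g :: "('a, 'b) ell2"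
    by (subst I1) simp
  show "inner f g = inner g f"
    unfolding inner_ell2_def by (rule I4)
  show "inner (f + g) h = inner f h + inner g h"
    unfolding inner_ell2_def by (subst (1 2 3) I4) (simp add: I2)
  show "inner (r *\<^sub>R f) g = r * inner f g"
    unfolding inner_ell2_def scaleR_ell2_def by (subst (1 2) I4) (simp add: I3)
  have J: "inner f f = (\<Sum>\<^sub>\<infinity>x. (norm (ell2_apply f x))\<^sup>2)" for f :: "('a, 'b) ell2"
    unfolding inner_ell2_def
    by transfer
      (simp add: power2_norm_eq_inner inner_eq_Re_cinner infsum_Re square_summable_cinner)
  show "0 \<le> inner f f"
    unfolding J by (intro infsum_nonneg) auto
  show "inner f f = 0 \<longleftrightarrow> f = 0"
  proof
    assume "inner f f = 0"
    then have "(norm (ell2_apply f x))\<^sup>2 = 0" for x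
      by (intro nonneg_infsum_le_0D[of "\<lambda>x. (norm (ell2_apply f x))\<^sup>2" UNIV])
        (use square_summable_ell2_apply[of f] in \<open>auto simp: J square_summable_def\<close>)
    then show "f = 0"
      by (intro ell2_eqI) (simp add: zero_ell2.rep_eq)
  qed (simp add: J zero_ell2.rep_eq)
  show "norm f = sqrt (inner f f)"
    by (rule norm_ell2_def)
qed (rule sgn_ell2_def dist_ell2_def uniformity_ell2_def open_ell2_def)+

end

lift_definition ell2_indicator :: "'x \<Rightarrow> ('x, complex) ell2" is "\<lambda>a. indicator {a}"
proof -
  fix a :: 'x
  have "(\<lambda>x. (norm (indicator {a} x :: complex))\<^sup>2) summable_on UNIV \<longleftrightarrow>
      (\<lambda>x. (norm (indicator {a} x :: complex))\<^sup>2) summable_on {a}"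
    by (rule summable_on_cong_neutral) auto
  then show "square_summable (indicator {a} :: 'x \<Rightarrow> complex)"
    by (simp add: square_summable_def)
qed

definition cadjoint :: "('a :: complex_inner \<Rightarrow> 'b :: complex_inner) \<Rightarrow> 'b \<Rightarrow> 'a"
  where "cadjoint A = (THE B. \<forall>x y. cinner (A x) y = cinner x (B y))"

lemma cadjoint_eqI:
  assumes "\<And>x y. cinner (A x) y = cinner x (B y)"
  shows "cadjoint A = B"
  unfolding cadjoint_def
proof (rule the_equality)
  fix B' assume *: "\<forall>x y. cinner (A x) y = cinner x (B' y)"
  show "B' = B"
  proof
    fix y
    have "cinner (B' y - B y) (B' y - B y) = 0"
      using assms[of "B' y - B y" y] * by (simp add: cinner_diff_right)
    then have "inner (B' y - B y) (B' y - B y) = 0"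
      by (simp add: inner_eq_Re_cinner)
    then show "B' y = B y"
      by simp
  qed
qed (use assms in blast)

text \<open>
  All operators used here are complex linear, hence so is the inverse of a bijective \<open>A - z\<close>, and
  real linearity in \<^const>\<open>bounded_linear\<close> is no restriction.
\<close>

definition resolvent_set :: "('a :: complex_inner \<Rightarrow> 'a) \<Rightarrow> complex set"
  where "resolvent_set A =
    {z. bij (\<lambda>f. A f - z *\<^sub>C f) \<and> bounded_linear (inv (\<lambda>f. A f - z *\<^sub>C f))}"

definition spectrum :: "('a :: complex_inner \<Rightarrow> 'a) \<Rightarrow> complex set"
  where "spectrum A = - resolvent_set A"

definition resolvent :: "('a :: complex_inner \<Rightarrow> 'a) \<Rightarrow> complex \<Rightarrow> 'a \<Rightarrow> 'a"
  where "resolvent A z = inv (\<lambda>f. A f - z *\<^sub>C f)"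

definition eigenspace :: "('a :: complex_inner \<Rightarrow> 'a) \<Rightarrow> complex \<Rightarrow> 'a set"
  where "eigenspace A z = {f. A f = z *\<^sub>C f}"

definition discrete_eigenvalue :: "('a :: complex_inner \<Rightarrow> 'a) \<Rightarrow> complex \<Rightarrow> bool"
  where "discrete_eigenvalue A z \<longleftrightarrow>
    z isolated_in spectrum A \<and>
    eigenspace A z \<noteq> {0} \<and>
    (\<exists>B. finite B \<and> eigenspace A z \<subseteq> module.span scaleC B)"

definition sigma1 :: "complex ^ 2 ^ 2"
  where "sigma1 = vector [vector [0, 1], vector [1, 0]]"
definition sigma_plus :: "complex ^ 2 ^ 2"
  where "sigma_plus = vector [vector [0, 1], vector [0, 0]]"
definition sigma3 :: "complex ^ 2 ^ 2"
  where "sigma3 = vector [vector [1, 0], vector [0, - 1]]"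

text \<open>
  The dimension \<open>d\<close> is the cardinality of the index type \<open>'d\<close>: the lattice is \<open>int ^ 'd\<close>,
  and \<open>complex ^ 2 ^ 'd\<close> is the \<open>d\<close>-fold direct sum of \<open>complex ^ 2\<close>.
\<close>

type_synonym 'd lattice = "int ^ 'd"
type_synonym 'd state_space = "('d lattice, complex ^ 2 ^ 'd) ell2"
type_synonym 'd scalar_space = "('d lattice, complex) ell2"

abbreviation unit_step :: "'d \<Rightarrow> 'd :: finite lattice"
  where "unit_step j \<equiv> axis j 1"

definition param_set :: "((real ^ 'd) \<times> (complex ^ 'd)) set"
  where "param_set = {(p, q). \<forall>j. (p $ j)\<^sup>2 + (cmod (q $ j))\<^sup>2 = 1}"

definition param_set_at :: "'d \<Rightarrow> ((real ^ 'd) \<times> (complex ^ 'd)) set"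
  where "param_set_at l = {(p, q) \<in> param_set. complex_of_real (p $ l) * q $ l \<noteq> 0}"

lemma square_summable_translate:
  fixes f :: "'d :: finite lattice \<Rightarrow> 'v :: real_normed_vector"
  assumes "square_summable f"
  shows "square_summable (\<lambda>x. f (x + a))" "square_summable (\<lambda>x. f (x - a))"
proof -
  have "bij (\<lambda>x. x + a)" "bij (\<lambda>x. x - a)"
    by (rule bij_betwI[of _ _ _ "\<lambda>x. x - a"], auto)
      (rule bij_betwI[of _ _ _ "\<lambda>x. x + a"], auto)
  then show "square_summable (\<lambda>x. f (x + a))" "square_summable (\<lambda>x. f (x - a))"
    using square_summable_bij[OF assms] by auto
qed

lemma square_summable_nth:
  "square_summable f \<Longrightarrow> square_summable (\<lambda>x. f x $ i :: 'v :: complex_inner)"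
  by (erule square_summable_le[where C = 1]) (simp add: Finite_Cartesian_Product.norm_nth_le)

lemma square_summable_vec:
  fixes f :: "'x \<Rightarrow> 'v :: complex_inner ^ 'n :: finite"
  assumes "\<And>i. square_summable (\<lambda>x. f x $ i)"
  shows "square_summable f"
proof -
  have "square_summable (\<lambda>x. \<Sum>i\<in>UNIV. norm (f x $ i))"
    using assms by (intro square_summable_sum) (simp add: square_summable_def)
  then show ?thesis
    by (rule square_summable_le[where C = 1]) (simp add: norm_vec_def L2_set_le_sum sum_nonneg)
qed

lift_definition component :: "'n \<Rightarrow> ('x, 'v :: complex_inner ^ 'n :: finite) ell2 \<Rightarrow> ('x, 'v) ell2"
  is "\<lambda>j f x. f x $ j" by (rule square_summable_nth)

lift_definition direct_sum :: "('n \<Rightarrow> ('x, 'v) ell2) \<Rightarrow> ('x, 'v :: complex_inner ^ 'n :: finite) ell2"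
  is "\<lambda>F x. \<chi> j. F j x" by (rule square_summable_vec) simp

lift_definition shift_component ::
  "real ^ 'd \<Rightarrow> complex ^ 'd \<Rightarrow> 'd \<Rightarrow> ('d :: finite lattice, complex ^ 2) ell2
    \<Rightarrow> ('d lattice, complex ^ 2) ell2"
  is "\<lambda>p q j f x. vector
    [complex_of_real (p $ j) * f x $ 1 + q $ j * f (x + unit_step j) $ 2,
     cnj (q $ j) * f (x - unit_step j) $ 1 - complex_of_real (p $ j) * f x $ 2]"
proof (rule square_summable_vec)
  fix p :: "real ^ 'd" and q :: "complex ^ 'd" and j :: 'd
    and f :: "'d lattice \<Rightarrow> complex ^ 2" and i :: 2
  assume f: "square_summable f"
  have A: "square_summable (\<lambda>x. a * g x $ k + b * h x $ l)"
    if "square_summable g" "square_summable h" for a b k l and g h :: "'d lattice \<Rightarrow> complex ^ 2"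
    using that square_summable_scaleC[of "\<lambda>x. g x $ k" a] square_summable_scaleC[of "\<lambda>x. h x $ l" b]
    by (intro square_summable_add) (simp_all add: scaleC_complex_def square_summable_nth)
  show "square_summable (\<lambda>x. (vector
      [complex_of_real (p $ j) * f x $ 1 + q $ j * f (x + unit_step j) $ 2,
       cnj (q $ j) * f (x - unit_step j) $ 1 - complex_of_real (p $ j) * f x $ 2]
        :: complex ^ 2) $ i)"
    using exhaust_2[of i]
      A[OF f square_summable_translate(1)[OF f], of "complex_of_real (p $ j)" 1 "q $ j" _ 2]
      A[OF square_summable_translate(2)[OF f] f, of "cnj (q $ j)" _ 1 "- complex_of_real (p $ j)" 2]
    by auto
qed

definition shift_operator :: "real ^ 'd \<Rightarrow> complex ^ 'd \<Rightarrow> 'd :: finite state_space \<Rightarrow> 'd state_space"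
  where "shift_operator p q \<Psi> = direct_sum (\<lambda>j. shift_component p q j (component j \<Psi>))"

definition chi_field :: "complex ^ 2 ^ 'd \<Rightarrow> complex ^ 2 ^ 'd \<Rightarrow> 'd :: finite lattice \<Rightarrow> complex ^ 2 ^ 'd"
  where "chi_field \<Phi> \<Omega> x = (if x = 0 then \<Omega> else \<Phi>)"

lemma norm_chi_field_le: "norm (chi_field \<Phi> \<Omega> x) \<le> norm \<Phi> + norm \<Omega>"
  by (simp add: chi_field_def)

lift_definition d_chi ::
  "complex ^ 2 ^ 'd \<Rightarrow> complex ^ 2 ^ 'd \<Rightarrow> 'd :: finite state_space \<Rightarrow> 'd scalar_space"
  is "\<lambda>\<Phi> \<Omega> \<Psi> x. cinner (chi_field \<Phi> \<Omega> x) (\<Psi> x)"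
proof (erule square_summable_le)
  fix \<Phi> \<Omega> :: "complex ^ 2 ^ 'd" and \<Psi> :: "'d lattice \<Rightarrow> complex ^ 2 ^ 'd" and x
  have "norm (cinner (chi_field \<Phi> \<Omega> x) (\<Psi> x)) \<le> 2 * (norm (chi_field \<Phi> \<Omega> x) * norm (\<Psi> x))"
    by (rule norm_cinner_le)
  also have "\<dots> \<le> 2 * ((norm \<Phi> + norm \<Omega>) * norm (\<Psi> x))"
    by (intro mult_left_mono mult_right_mono norm_chi_field_le) auto
  finally show "norm (cinner (chi_field \<Phi> \<Omega> x) (\<Psi> x)) \<le> (2 * (norm \<Phi> + norm \<Omega>)) * norm (\<Psi> x)"
    by (simp only: mult.assoc)
qed

definition discriminant ::
  "real ^ 'd \<Rightarrow> complex ^ 'd \<Rightarrow> complex ^ 2 ^ 'd \<Rightarrow> complex ^ 2 ^ 'd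
    \<Rightarrow> 'd :: finite scalar_space \<Rightarrow> 'd scalar_space"
  where "discriminant p q \<Phi> \<Omega> = d_chi \<Phi> \<Omega> \<circ> shift_operator p q \<circ> cadjoint (d_chi \<Phi> \<Omega>)"

definition a_coeff :: "complex ^ 2 ^ 'd \<Rightarrow> real ^ 'd \<Rightarrow> complex"
  where "a_coeff \<Omega> p = (\<Sum>j\<in>UNIV. complex_of_real (p $ j) * cinner (\<Omega> $ j) (sigma3 *v \<Omega> $ j))"

definition alpha :: "complex ^ 'd \<Rightarrow> complex ^ 2 ^ 'd \<Rightarrow> 'd \<Rightarrow> complex"
  where "alpha q \<Phi> j = q $ j * cnj (\<Phi> $ j $ 1) * \<Phi> $ j $ 2"

lift_definition translation :: "'d \<Rightarrow> 'd :: finite scalar_space \<Rightarrow> 'd scalar_space"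
  is "\<lambda>j f x. f (x + unit_step j)" by (rule square_summable_translate)

definition T0 ::
  "real ^ 'd \<Rightarrow> complex ^ 'd \<Rightarrow> complex ^ 2 ^ 'd \<Rightarrow> 'd :: finite scalar_space \<Rightarrow> 'd scalar_space"
  where "T0 p q \<Phi> f = a_coeff \<Phi> p *\<^sub>C f +
    (\<Sum>j\<in>UNIV. alpha q \<Phi> j *\<^sub>C translation j f +
      cnj (alpha q \<Phi> j) *\<^sub>C cadjoint (translation j) f)"

definition phi_vec ::
  "complex ^ 'd \<Rightarrow> complex ^ 2 ^ 'd \<Rightarrow> complex ^ 2 ^ 'd \<Rightarrow> 'd :: finite scalar_space"
  where "phi_vec q \<Phi> \<Omega> = (\<Sum>j\<in>UNIV.
    (q $ j * \<Omega> $ j $ 2 * cnj (\<Phi> $ j $ 1)) *\<^sub>C ell2_indicator (- unit_step j) +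
    (cnj (q $ j) * \<Omega> $ j $ 1 * cnj (\<Phi> $ j $ 2)) *\<^sub>C ell2_indicator (unit_step j))"

text \<open>
  The values of this function are real off the spectrum of \<open>T0\<close>; see \<open>frakf_real\<close> below.
\<close>

definition frakf ::
  "real ^ 'd \<Rightarrow> complex ^ 'd \<Rightarrow> complex ^ 2 ^ 'd \<Rightarrow> complex ^ 2 ^ 'd :: finite \<Rightarrow> real \<Rightarrow> complex"
  where "frakf p q \<Phi> \<Omega> lam = complex_of_real lam - a_coeff \<Omega> p +
    cinner (phi_vec q \<Phi> \<Omega>) (resolvent (T0 p q \<Phi>) (complex_of_real lam) (phi_vec q \<Phi> \<Omega>))"

lift_definition d_chi_adj ::
  "complex ^ 2 ^ 'd \<Rightarrow> complex ^ 2 ^ 'd \<Rightarrow> 'd :: finite scalar_space \<Rightarrow> 'd state_space"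
  is "\<lambda>\<Phi> \<Omega> f x. f x *\<^sub>C chi_field \<Phi> \<Omega> x"
proof (erule square_summable_le)
  fix \<Phi> \<Omega> :: "complex ^ 2 ^ 'd" and f :: "'d lattice \<Rightarrow> complex" and x
  show "norm (f x *\<^sub>C chi_field \<Phi> \<Omega> x) \<le> (norm \<Phi> + norm \<Omega>) * norm (f x)"
    by (metis mult.commute mult_left_mono norm_chi_field_le norm_ge_zero norm_scaleC)
qed

lemma cadjoint_d_chi: "cadjoint (d_chi \<Phi> \<Omega>) = d_chi_adj \<Phi> \<Omega>"
proof (rule cadjoint_eqI)
  fix \<Psi> f
  show "cinner (d_chi \<Phi> \<Omega> \<Psi>) f = cinner \<Psi> (d_chi_adj \<Phi> \<Omega> f)"
  proof transfer
    fix \<Phi> \<Omega> :: "complex ^ 2 ^ 'd" and \<Psi> and f :: "'d lattice \<Rightarrow> complex"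
    have "cinner (cinner (chi_field \<Phi> \<Omega> x) (\<Psi> x)) (f x) =
        cinner (\<Psi> x) (f x *\<^sub>C chi_field \<Phi> \<Omega> x)" for x
      by (simp add: cinner_complex_def cinner_scaleC_right mult.commute flip: cinner_commute)
    then show "(\<Sum>\<^sub>\<infinity>x. cinner (cinner (chi_field \<Phi> \<Omega> x) (\<Psi> x)) (f x)) =
        (\<Sum>\<^sub>\<infinity>x. cinner (\<Psi> x) (f x *\<^sub>C chi_field \<Phi> \<Omega> x))"
      by simp
  qed
qed

lift_definition translation_adj :: "'d \<Rightarrow> 'd :: finite scalar_space \<Rightarrow> 'd scalar_space"
  is "\<lambda>j f x. f (x - unit_step j)" by (rule square_summable_translate)

lemma cinner_translation: "cinner (translation j f) g = cinner f (translation_adj j g)"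
proof transfer
  fix j :: "'d :: finite" and f g :: "'d lattice \<Rightarrow> complex"
  show "(\<Sum>\<^sub>\<infinity>x. cinner (f (x + unit_step j)) (g x)) =
      (\<Sum>\<^sub>\<infinity>x. cinner (f x) (g (x - unit_step j)))"
    by (rule infsum_reindex_bij_witness[of _ "\<lambda>x. x - unit_step j" "\<lambda>x. x + unit_step j"]) auto
qed

lemma cadjoint_translation: "cadjoint (translation j) = translation_adj j"
  by (rule cadjoint_eqI) (rule cinner_translation)

lemma a_coeff_real: "a_coeff \<Omega> p \<in> \<real>"
proof -
  have "cinner (\<Omega> $ j) (sigma3 *v \<Omega> $ j) \<in> \<real>" for j
    by (auto simp: cinner_vec_def cinner_complex_def sum_2 sigma3_def matrix_vector_mult_def
        complex_is_Real_iff)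
  then show ?thesis
    unfolding a_coeff_def by (intro sum_in_Reals Reals_mult) auto
qed

lemma T0_symmetric: "cinner (T0 p q \<Phi> f) g = cinner f (T0 p q \<Phi> g)"
proof -
  have *: "cinner (translation_adj j f) g = cinner f (translation j g)" for j
    by (metis cinner_commute cinner_translation)
  have "cnj (a_coeff \<Phi> p) = a_coeff \<Phi> p"
    using a_coeff_real by (simp add: Reals_cnj_iff)
  then show ?thesis
    by (simp add: T0_def cinner_add_left cinner_add_right cinner_sum_left cinner_sum_right
        cinner_scaleC_left cinner_scaleC_right cadjoint_translation cinner_translation * add.commute)
qed

lemma frakf_real:
  assumes "complex_of_real lam \<notin> spectrum (T0 p q \<Phi>)"
  shows "frakf p q \<Phi> \<Omega> lam \<in> \<real>"
proof -
  define A where "A = (\<lambda>f. T0 p q \<Phi> f - complex_of_real lam *\<^sub>C f)"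
  define v where "v = phi_vec q \<Phi> \<Omega>"
  define g where "g = resolvent (T0 p q \<Phi>) (complex_of_real lam) v"
  have "bij A"
    using assms by (auto simp: spectrum_def resolvent_set_def A_def)
  then have v: "v = A g"
    by (simp add: g_def resolvent_def bij_is_surj surj_f_inv_f flip: A_def)
  have "cinner (A g) g = cinner g (A g)"
    by (simp add: A_def cinner_diff_left cinner_diff_right cinner_scaleC_left cinner_scaleC_right
        T0_symmetric)
  then have "cinner v g \<in> \<real>"
    by (metis Reals_cnj_iff cinner_commute v)
  then show ?thesis
    using a_coeff_real unfolding frakf_def v_def g_def by (intro Reals_add Reals_diff) auto
qed

end

theory Submission
  imports Defs
begin

text \<open>
  Let \<open>\<delta>\<close> be the indicator of the origin and \<open>Q\<close> the projection onto its orthogonal complement.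
  Then \<open>T = Q T0 Q + |\<phi>\<rangle>\<langle>\<delta>| + |\<delta>\<rangle>\<langle>\<phi>| + a |\<delta>\<rangle>\<langle>\<delta>|\<close>. The reflection \<open>x \<mapsto> - x\<close>, multiplied by the character that
  exchanges \<open>\<alpha>\<^sub>j L\<^sub>j\<close> with its adjoint, commutes with \<open>T0\<close> and fixes \<open>\<delta>\<close>; by hypothesis (a) it maps
  \<open>\<phi>\<close> to \<open>- \<phi>\<close>. Hence \<open>\<delta>\<close> is orthogonal to \<open>R(z) \<phi>\<close>, where \<open>R(z)\<close> is the resolvent of \<open>T0\<close>,
  and \<open>\<delta> - R(\<lambda>) \<phi>\<close> is an eigenvector of \<open>T\<close> at every zero \<open>\<lambda>\<close> of \<open>\<ff>\<close>.
  The same decoupling shows that the eigenspace lies in the span of \<open>\<delta>\<close>, \<open>R(\<lambda>) \<delta>\<close>, \<open>R(\<lambda>) \<phi>\<close>, and that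
  \<open>T - z\<close> is explicitly invertible as soon as \<open>\<ff>(z)\<close> and \<open>\<langle>\<delta>, R(z) \<delta>\<rangle>\<close> are nonzero. Both functions
  have positive derivative at real points of the resolvent set, so their zeros there are isolated.
\<close>

section \<open>Resolvents\<close>

interpretation complex_vector: vector_space "scaleC :: complex \<Rightarrow> 'a \<Rightarrow> 'a :: complex_inner"
  by (rule vector_space_scaleC)

lemma cinner_minus_left: "cinner (- x) y = - cinner x (y :: 'a :: complex_inner)"
  using cinner_diff_left[of 0 x y] by simp

lemma cinner_minus_right: "cinner x (- y) = - cinner x (y :: 'a :: complex_inner)"
  using cinner_diff_right[of x 0 y] by simp

lemma cinner_self: "cinner x x = complex_of_real ((norm (x :: 'a :: complex_inner))\<^sup>2)"
proof -
  have "Im (cinner x x) = 0"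
    using cinner_commute[of x x] by (metis Reals_cnj_iff complex_is_Real_iff)
  then show ?thesis
    by (simp add: complex_eq_iff power2_norm_eq_inner inner_eq_Re_cinner)
qed

lemma bounded_linear_cinner_right: "bounded_linear (cinner (x :: 'a :: complex_inner))"
proof (rule bounded_linear_intro)
  show "norm (cinner x y) \<le> norm y * (2 * norm x)" for y
    using norm_cinner_le[of x y] by (simp add: mult_ac)
qed (simp_all add: cinner_add_right cinner_scaleC_right scaleR_scaleC scaleC_complex_def)

lemma bounded_linear_scaleC_left: "bounded_linear (\<lambda>c. c *\<^sub>C (x :: 'a :: complex_inner))"
  by (rule bounded_linear_intro[where K = "norm x"])
    (simp_all add: scaleC_add_left scaleR_scaleC scaleC_scaleC norm_scaleC scaleC_complex_def)

text \<open>\<open>resolvent_set\<close> records only real linearity of the inverse, so complex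
  linearity is tracked separately; it passes from \<open>A\<close> to its resolvent.\<close>

definition clinear :: "('a :: complex_inner \<Rightarrow> 'b :: complex_inner) \<Rightarrow> bool"
  where "clinear A \<longleftrightarrow> (\<forall>x y. A (x + y) = A x + A y) \<and> (\<forall>c x. A (c *\<^sub>C x) = c *\<^sub>C A x)"

lemma clinear_add: "clinear A \<Longrightarrow> A (x + y) = A x + A y"
  and clinear_scaleC: "clinear A \<Longrightarrow> A (c *\<^sub>C x) = c *\<^sub>C A x"
  by (auto simp: clinear_def)

lemma clinear_diff: "clinear A \<Longrightarrow> A (x - y) = A x - A y"
  using clinear_add[of A "x - y" y] by simp

lemma clinear_minus: "clinear A \<Longrightarrow> A (- x) = - A x"
  using clinear_scaleC[of A "-1" x] by simp

section \<open>Algebra of a single resolvent\<close>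

lemma resolvent_works:
  assumes "z \<in> resolvent_set A"
  shows "A (resolvent A z x) - z *\<^sub>C resolvent A z x = x"
  using assms unfolding resolvent_set_def resolvent_def
  by (metis (no_types, lifting) bij_inv_eq_iff mem_Collect_eq)

lemma resolvent_eqI:
  assumes "z \<in> resolvent_set A" "A y - z *\<^sub>C y = x"
  shows "resolvent A z x = y"
  using assms unfolding resolvent_set_def resolvent_def
  by (metis (no_types, lifting) bij_inv_eq_iff mem_Collect_eq)

lemma bounded_linear_resolvent:
  "z \<in> resolvent_set A \<Longrightarrow> bounded_linear (resolvent A z)"
  by (simp add: resolvent_set_def resolvent_def)

lemma clinear_resolvent:
  assumes "clinear A" "z \<in> resolvent_set A"
  shows "clinear (resolvent A z)"
  unfolding clinear_def
proof (intro conjI allI)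
  fix x y c
  show "resolvent A z (x + y) = resolvent A z x + resolvent A z y"
    using resolvent_works[OF assms(2), of x] resolvent_works[OF assms(2), of y]
    by (intro resolvent_eqI[OF assms(2)])
      (simp add: clinear_add[OF assms(1)] scaleC_add_right algebra_simps)
  have "c *\<^sub>C x = c *\<^sub>C (A (resolvent A z x) - z *\<^sub>C resolvent A z x)"
    by (simp add: resolvent_works[OF assms(2)])
  then show "resolvent A z (c *\<^sub>C x) = c *\<^sub>C resolvent A z x"
    by (intro resolvent_eqI[OF assms(2)])
      (simp add: clinear_scaleC[OF assms(1)] complex_vector.scale_right_diff_distrib
        scaleC_scaleC mult.commute)
qed

text \<open>A right inverse \<open>B\<close> of an injective map is its inverse, so boundedness need
  only be checked for the explicit \<open>B\<close>.\<close>

lemma resolvent_setI: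
  assumes "\<And>x y. A x - z *\<^sub>C x = A y - z *\<^sub>C y \<Longrightarrow> x = y"
    and "\<And>x. A (B x) - z *\<^sub>C B x = x" and "bounded_linear B"
  shows "z \<in> resolvent_set A"
proof -
  let ?f = "\<lambda>f. A f - z *\<^sub>C f"
  have bij: "bij ?f"
    by (rule bijI, rule injI, erule assms(1)) (rule surjI, rule assms(2))
  then have "inv ?f = B"
    by (intro ext inv_f_eq bij_is_inj assms(2))
  then show ?thesis
    using bij assms(3) by (simp add: resolvent_set_def)
qed

section \<open>Openness of the resolvent set and continuity of the resolvent\<close>

text \<open>Solving \<open>A f - w *\<^sub>C f = h\<close> amounts to finding a fixed point of
  \<open>f \<mapsto> resolvent A z (h + (w - z) *\<^sub>C f)\<close>. For \<open>w\<close> close to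
  \<open>z\<close> this map is a contraction with factor 1/2, so completeness gives a unique
  solution.\<close>

lemma resolvent_set_near:
  fixes A :: "'a :: {complex_inner, complete_space} \<Rightarrow> 'a"
  assumes A: "clinear A" and z: "z \<in> resolvent_set A"
  obtains K where "K > 0"
    and "\<And>w. cmod (w - z) * K \<le> 1 / 2 \<Longrightarrow> w \<in> resolvent_set A"
    and "\<And>w x. cmod (w - z) * K \<le> 1 / 2 \<Longrightarrow> norm (resolvent A w x) \<le> 2 * K * norm x"
proof -
  obtain K where K: "K > 0" "\<And>x. norm (resolvent A z x) \<le> norm x * K"
    using bounded_linear.pos_bounded[OF bounded_linear_resolvent[OF z]] by blast
  note lin = clinear_resolvent[OF A z]
  have eq: "A f - w *\<^sub>C f = h \<longleftrightarrow> resolvent A z (h + (w - z) *\<^sub>C f) = f" for f w h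
  proof
    assume "A f - w *\<^sub>C f = h"
    then show "resolvent A z (h + (w - z) *\<^sub>C f) = f"
      by (intro resolvent_eqI[OF z]) (auto simp: complex_vector.scale_left_diff_distrib)
  next
    assume "resolvent A z (h + (w - z) *\<^sub>C f) = f"
    then have "A f - z *\<^sub>C f = h + (w - z) *\<^sub>C f"
      using resolvent_works[OF z] by metis
    then show "A f - w *\<^sub>C f = h"
      by (simp add: complex_vector.scale_left_diff_distrib algebra_simps)
  qed
  have ex: "\<exists>!f. A f - w *\<^sub>C f = h" if w: "cmod (w - z) * K \<le> 1 / 2" for w h
    unfolding eq
  proof (rule banach_fix_type[where c = "1 / 2"])
    show "\<forall>x y. dist (resolvent A z (h + (w - z) *\<^sub>C x)) (resolvent A z (h + (w - z) *\<^sub>C y))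
        \<le> 1 / 2 * dist x y"
    proof (intro allI)
      fix x y
      have "dist (resolvent A z (h + (w - z) *\<^sub>C x)) (resolvent A z (h + (w - z) *\<^sub>C y))
          = norm (resolvent A z ((w - z) *\<^sub>C (x - y)))"
        by (simp add: dist_norm complex_vector.scale_right_diff_distrib flip: clinear_diff[OF lin])
      also have "\<dots> \<le> norm ((w - z) *\<^sub>C (x - y)) * K"
        by (rule K)
      also have "\<dots> = (cmod (w - z) * K) * norm (x - y)"
        by (simp add: norm_scaleC)
      also have "\<dots> \<le> 1 / 2 * dist x y"
        unfolding dist_norm by (intro mult_right_mono w) auto
      finally show "dist (resolvent A z (h + (w - z) *\<^sub>C x)) (resolvent A z (h + (w - z) *\<^sub>C y))
          \<le> 1 / 2 * dist x y" .
    qed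
  qed auto
  \<comment> \<open>The fixed-point equation yields
    \<open>norm f \<le> K * norm h + norm f / 2\<close>; absorbing the last term produces the factor
    2, uniformly in \<open>w\<close>.\<close>
  have bound: "norm f \<le> 2 * K * norm h" if w: "cmod (w - z) * K \<le> 1 / 2" and f: "A f - w *\<^sub>C f = h"
    for w f h
  proof -
    have "norm f = norm (resolvent A z (h + (w - z) *\<^sub>C f))"
      using f eq by simp
    also have "\<dots> \<le> norm (h + (w - z) *\<^sub>C f) * K"
      by (rule K)
    also have "\<dots> \<le> (norm h + norm ((w - z) *\<^sub>C f)) * K"
      using K(1) by (intro mult_right_mono norm_triangle_ineq) auto
    also have "\<dots> = K * norm h + (cmod (w - z) * K) * norm f"
      by (simp add: norm_scaleC distrib_left mult_ac)
    also have "\<dots> \<le> K * norm h + 1 / 2 * norm f"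
      by (intro add_left_mono mult_right_mono w) auto
    finally show ?thesis
      by simp
  qed
  have mem: "w \<in> resolvent_set A" if w: "cmod (w - z) * K \<le> 1 / 2" for w
  proof -
    \<comment> \<open>Linearity of \<open>B\<close> follows from uniqueness of solutions.\<close>
    define B where "B h = (THE f. A f - w *\<^sub>C f = h)" for h
    have B: "A (B h) - w *\<^sub>C B h = h" for h
      unfolding B_def by (rule theI'[OF ex[OF w]])
    have B_eq: "B h = f" if "A f - w *\<^sub>C f = h" for f h
      unfolding B_def using that ex[OF w] by (intro the1_equality) auto
    have "bounded_linear B"
    proof (rule bounded_linear_intro)
      show "B (x + y) = B x + B y" for x y
        using B[of x] B[of y]
        by (intro B_eq) (simp add: clinear_add[OF A] scaleC_add_right algebra_simps)
      show "B (r *\<^sub>R x) = r *\<^sub>R B x" for r x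
      proof (rule B_eq)
        have "r *\<^sub>R x = r *\<^sub>R (A (B x) - w *\<^sub>C B x)"
          by (simp add: B)
        then show "A (r *\<^sub>R B x) - w *\<^sub>C r *\<^sub>R B x = r *\<^sub>R x"
          by (simp add: scaleR_scaleC clinear_scaleC[OF A]
              complex_vector.scale_right_diff_distrib scaleC_scaleC mult.commute)
      qed
      show "norm (B x) \<le> norm x * (2 * K)" for x
        using bound[OF w B] by (simp add: mult_ac)
    qed
    then show ?thesis
      using ex[OF w] B by (intro resolvent_setI[where B = B]) auto
  qed
  show thesis
    using K(1) mem bound[OF _ resolvent_works[OF mem]] by (rule that)
qed

text \<open>Applying \<open>A - w\<close> to \<open>resolvent A z x\<close> leaves \<open>x\<close>
  minus a multiple of that vector. With \<open>resolvent A w\<close> outermost, the uniform bound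
  near \<open>z\<close> applies to the right-hand side while the inner vector stays fixed.\<close>

lemma resolvent_identity:
  assumes A: "clinear A" and z: "z \<in> resolvent_set A" and w: "w \<in> resolvent_set A"
  shows "resolvent A w x - resolvent A z x = (w - z) *\<^sub>C resolvent A w (resolvent A z x)"
proof -
  let ?y = "resolvent A z x"
  have "A ?y - w *\<^sub>C ?y = x - (w - z) *\<^sub>C ?y"
    using resolvent_works[OF z, of x]
    by (simp add: complex_vector.scale_left_diff_distrib algebra_simps)
  then have "?y = resolvent A w (x - (w - z) *\<^sub>C ?y)"
    using resolvent_eqI[OF w] by metis
  also have "\<dots> = resolvent A w x - (w - z) *\<^sub>C resolvent A w ?y"
    by (simp add: clinear_diff clinear_scaleC clinear_resolvent[OF A w])
  finally show ?thesis
    by (simp add: algebra_simps)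
qed

lemma eventually_mult_cmod_diff_le:
  "\<forall>\<^sub>F w in at z. cmod (w - z) * K \<le> 1 / 2"
proof -
  have "((\<lambda>w. cmod (w - z) * K) \<longlongrightarrow> cmod (z - z) * K) (at z)"
    by (intro tendsto_intros)
  then have "((\<lambda>w. cmod (w - z) * K) \<longlongrightarrow> 0) (at z)"
    by simp
  then have "\<forall>\<^sub>F w in at z. cmod (w - z) * K < 1 / 2"
    by (rule order_tendstoD) simp
  then show ?thesis
    by (rule eventually_mono) simp
qed

lemma eventually_resolvent_set:
  fixes A :: "'a :: {complex_inner, complete_space} \<Rightarrow> 'a"
  assumes "clinear A" "z \<in> resolvent_set A"
  shows "\<forall>\<^sub>F w in at z. w \<in> resolvent_set A"
proof -
  obtain K where "K > 0" "\<And>w. cmod (w - z) * K \<le> 1 / 2 \<Longrightarrow> w \<in> resolvent_set A"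
    "\<And>w x. cmod (w - z) * K \<le> 1 / 2 \<Longrightarrow> norm (resolvent A w x) \<le> 2 * K * norm x"
    using assms by (rule resolvent_set_near) blast
  with eventually_mult_cmod_diff_le[of z K] show ?thesis
    by (auto elim: eventually_mono)
qed

lemma tendsto_resolvent:
  fixes A :: "'a :: {complex_inner, complete_space} \<Rightarrow> 'a"
  assumes A: "clinear A" and z: "z \<in> resolvent_set A"
  shows "((\<lambda>w. resolvent A w x) \<longlongrightarrow> resolvent A z x) (at z)"
proof -
  obtain K where "K > 0" and K: "\<And>w. cmod (w - z) * K \<le> 1 / 2 \<Longrightarrow> w \<in> resolvent_set A"
    "\<And>w x. cmod (w - z) * K \<le> 1 / 2 \<Longrightarrow> norm (resolvent A w x) \<le> 2 * K * norm x"
    using A z by (rule resolvent_set_near) blast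
  have "((\<lambda>w. resolvent A w x - resolvent A z x) \<longlongrightarrow> 0) (at z)"
  proof (rule Lim_null_comparison)
    show "\<forall>\<^sub>F w in at z. norm (resolvent A w x - resolvent A z x)
        \<le> cmod (w - z) * (2 * K * norm (resolvent A z x))"
      using eventually_mult_cmod_diff_le[of z K]
    proof (rule eventually_mono)
      fix w assume w: "cmod (w - z) * K \<le> 1 / 2"
      show "norm (resolvent A w x - resolvent A z x)
          \<le> cmod (w - z) * (2 * K * norm (resolvent A z x))"
        unfolding resolvent_identity[OF A z K(1)[OF w]] norm_scaleC
        by (intro mult_left_mono K(2)[OF w]) auto
    qed
    have "((\<lambda>w. cmod (w - z) * (2 * K * norm (resolvent A z x)))
        \<longlongrightarrow> cmod (z - z) * (2 * K * norm (resolvent A z x))) (at z)"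
      by (intro tendsto_intros)
    then show "((\<lambda>w. cmod (w - z) * (2 * K * norm (resolvent A z x))) \<longlongrightarrow> 0) (at z)"
      by simp
  qed
  then show ?thesis
    by (rule LIM_zero_cancel)
qed

section \<open>Isolated zeros of resolvent matrix elements\<close>

text \<open>For real \<open>lam\<close> the operator \<open>A - lam\<close> is symmetric and can be
  moved across the inner product once \<open>y\<close> is written as its image.\<close>

lemma cinner_resolvent_symmetric:
  assumes sym: "\<And>x y. cinner (A x) y = cinner x (A y)"
    and lam: "complex_of_real lam \<in> resolvent_set A"
  shows "cinner (resolvent A (of_real lam) x) y = cinner x (resolvent A (of_real lam) y)"
proof -
  let ?R = "resolvent A (of_real lam)"
  have "cinner (?R x) y = cinner (?R x) (A (?R y) - complex_of_real lam *\<^sub>C ?R y)"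
    by (simp add: resolvent_works[OF lam])
  also have "\<dots> = cinner (A (?R x) - complex_of_real lam *\<^sub>C ?R x) (?R y)"
    by (simp add: cinner_diff_left cinner_diff_right cinner_scaleC_left cinner_scaleC_right sym)
  finally show ?thesis
    by (simp add: resolvent_works[OF lam])
qed

text \<open>
  By the resolvent identity the function below has derivative
  \<open>k + (norm (R v))\<^sup>2 > 0\<close> at a real point of the resolvent set.
\<close>

lemma eventually_cinner_resolvent_nonzero:
  fixes A :: "'a :: {complex_inner, complete_space} \<Rightarrow> 'a"
  assumes A: "clinear A" and sym: "\<And>x y. cinner (A x) y = cinner x (A y)"
    and lam: "complex_of_real lam \<in> resolvent_set A"
    and k: "k \<ge> 0" "k > 0 \<or> v \<noteq> 0"
  shows "\<forall>\<^sub>F z in at (complex_of_real lam).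
    of_real k * z + b + cinner v (resolvent A z v) \<noteq> 0"
proof -
  let ?l = "complex_of_real lam"
  let ?h = "\<lambda>z. of_real k * z + b + cinner v (resolvent A z v)"
  let ?g = "resolvent A ?l v"
  have lim: "((\<lambda>z. cinner u (resolvent A z x)) \<longlongrightarrow> cinner u (resolvent A ?l x)) (at ?l)" for u x
    by (rule bounded_linear.tendsto[OF bounded_linear_cinner_right tendsto_resolvent[OF A lam]])
  show ?thesis
  proof (cases "?h ?l = 0")
    case False
    have "(?h \<longlongrightarrow> ?h ?l) (at ?l)"
      by (intro tendsto_intros lim)
    then show ?thesis
      using False by (rule tendsto_imp_eventually_ne)
  next
    case True
    have "cinner v (resolvent A ?l ?g) = cinner ?g ?g"
      by (rule cinner_resolvent_symmetric[OF sym lam, symmetric])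
    then have "of_real k + cinner v (resolvent A ?l ?g) = complex_of_real (k + (norm ?g)\<^sup>2)"
      by (simp add: cinner_self)
    moreover have "k + (norm ?g)\<^sup>2 > 0"
    proof (cases "k > 0")
      case False
      \<comment> \<open>If \<open>?g\<close> were zero, then \<open>v\<close>, the image of
        \<open>?g\<close> under \<open>A - lam\<close>, would vanish as well.\<close>
      have "A 0 = 0"
        using clinear_diff[OF A, of 0 0] by simp
      then have "?g \<noteq> 0"
        using False k resolvent_works[OF lam, of v] by auto
      then show ?thesis
        using k by (simp add: add_nonneg_pos)
    qed (simp add: add_pos_nonneg)
    ultimately have "of_real k + cinner v (resolvent A ?l ?g) \<noteq> 0"
      by (metis of_real_eq_0_iff less_irrefl)
    moreover have "((\<lambda>z. of_real k + cinner v (resolvent A z ?g))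
        \<longlongrightarrow> of_real k + cinner v (resolvent A ?l ?g)) (at ?l)"
      by (intro tendsto_intros lim)
    ultimately have "\<forall>\<^sub>F z in at ?l. of_real k + cinner v (resolvent A z ?g) \<noteq> 0"
      using tendsto_imp_eventually_ne by blast
    then show ?thesis
      using eventually_resolvent_set[OF A lam] eventually_neq_at_within[of ?l ?l UNIV]
    proof eventually_elim
      case (elim z)
      \<comment> \<open>The resolvent identity splits off the factor \<open>z - ?l\<close> from
        \<open>?h z - ?h ?l\<close>; the remaining factor is nonzero near \<open>?l\<close>.\<close>
      have "resolvent A z v = ?g + (z - ?l) *\<^sub>C resolvent A z ?g"
        by (simp flip: resolvent_identity[OF A lam elim(2)])
      then have "?h z = ?h ?l + (z - ?l) * (of_real k + cinner v (resolvent A z ?g))"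
        by (simp only: cinner_add_right cinner_scaleC_right) (simp add: algebra_simps)
      then show ?case
        using True elim by simp
    qed
  qed
qed

section \<open>Perturbations odd under a reflection\<close>

text \<open>\<open>V\<close> is a symmetry of \<open>A\<close> under which \<open>e\<close> is even
  and \<open>v\<close> is odd, so functions of \<open>A\<close> cannot couple the two vectors. On
  the lattice, \<open>A\<close> is \<open>T0\<close>, \<open>e\<close> is the indicator of the
  origin and \<open>v\<close> is \<open>phi_vec\<close>.\<close>

locale reflected_perturbation =
  fixes A V :: "'a :: {complex_inner, complete_space} \<Rightarrow> 'a" and e v :: 'a and a :: complex
  assumes A: "clinear A" and symmetric: "\<And>x y. cinner (A x) y = cinner x (A y)"
    and e: "cinner e e = 1" and e_v: "cinner e v = 0"
    and V: "clinear V" and V_A: "\<And>x. V (A x) = A (V x)"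
    and V_isometry: "\<And>x y. cinner (V x) (V y) = cinner x y"
    and V_e: "V e = e" and V_v: "V v = - v"
begin

definition Q :: "'a \<Rightarrow> 'a"
  where "Q f = f - cinner e f *\<^sub>C e"

definition T :: "'a \<Rightarrow> 'a"
  where "T f = Q (A (Q f)) + cinner e f *\<^sub>C v + (cinner v f + a * cinner e f) *\<^sub>C e"

text \<open>Minus the Schur complement of \<open>T - z\<close> on the line of \<open>e\<close>.
  Decoupling puts the resolvent of \<open>A\<close> where that of the compression
  \<open>Q A Q\<close> would be expected.\<close>

definition feshbach :: "complex \<Rightarrow> complex"
  where "feshbach z = z - a + cinner v (resolvent A z v)"

lemma v_e: "cinner v e = 0"
  using e_v cinner_commute[of v e] by simp

lemma e_nonzero: "e \<noteq> 0"
  using e by auto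

lemma clinear_Q: "clinear Q"
  by (simp add: clinear_def Q_def cinner_add_right cinner_scaleC_right scaleC_add_left
      complex_vector.scale_right_diff_distrib scaleC_scaleC)

lemma clinear_T: "clinear T"
  unfolding clinear_def T_def
  by (simp add: clinear_add[OF clinear_Q] clinear_scaleC[OF clinear_Q] clinear_add[OF A]
      clinear_scaleC[OF A] cinner_add_right cinner_scaleC_right scaleC_add_left scaleC_add_right
      scaleC_scaleC algebra_simps)

lemma Q_e: "Q e = 0" and Q_v: "Q v = v" and e_Q: "cinner e (Q f) = 0"
  and v_Q: "cinner v (Q f) = cinner v f"
  by (simp_all add: Q_def e e_v v_e cinner_diff_right cinner_scaleC_right)

lemma Q_decomposition: "f = cinner e f *\<^sub>C e + Q f"
  by (simp add: Q_def)

lemma V_resolvent: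
  assumes "z \<in> resolvent_set A"
  shows "V (resolvent A z x) = resolvent A z (V x)"
proof (rule resolvent_eqI[OF assms, symmetric])
  have "V x = V (A (resolvent A z x) - z *\<^sub>C resolvent A z x)"
    by (simp add: resolvent_works[OF assms])
  then show "A (V (resolvent A z x)) - z *\<^sub>C V (resolvent A z x) = V x"
    by (simp add: clinear_diff[OF V] clinear_scaleC[OF V] V_A)
qed

text \<open>Inserting the isometry \<open>V\<close>, which commutes with the resolvent, into both
  slots changes the sign of each inner product.\<close>

lemma resolvent_decoupled:
  assumes "z \<in> resolvent_set A"
  shows "cinner e (resolvent A z v) = 0" "cinner v (resolvent A z e) = 0"
proof -
  note R = clinear_minus[OF clinear_resolvent[OF A assms]]
  have "cinner e (resolvent A z v) = cinner (V e) (V (resolvent A z v))"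
    "cinner v (resolvent A z e) = cinner (V v) (V (resolvent A z e))"
    by (simp_all only: V_isometry)
  then show "cinner e (resolvent A z v) = 0" "cinner v (resolvent A z e) = 0"
    by (simp_all add: V_resolvent[OF assms] V_e V_v R cinner_minus_left cinner_minus_right)
qed

text \<open>\<open>T\<close> discards the \<open>e\<close>-component \<open>s\<close> of
  \<open>A (Q f)\<close>. Restoring it as a free multiplier turns the eigenvalue equation into one
  for \<open>A - z\<close>, solved by the resolvent of \<open>A\<close>. This serves both
  injectivity of \<open>T - z\<close> and finite multiplicity.\<close>

lemma T_eigenvector_form:
  assumes z: "z \<in> resolvent_set A" and f: "T f = z *\<^sub>C f"
  obtains s where "Q f = s *\<^sub>C resolvent A z e - cinner e f *\<^sub>C resolvent A z v"
    and "cinner v f + a * cinner e f = z * cinner e f"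
proof -
  note R = clinear_resolvent[OF A z]
  define s where "s = cinner e (A (Q f))"
  have "cinner e (T f) = cinner v f + a * cinner e f"
    by (simp add: T_def cinner_add_right cinner_scaleC_right e_Q e_v e)
  then have 1: "cinner v f + a * cinner e f = z * cinner e f"
    by (simp add: f cinner_scaleC_right)
  have "A (Q f) = Q (A (Q f)) + s *\<^sub>C e"
    by (simp add: s_def Q_def)
  also have "Q (A (Q f)) = z *\<^sub>C f - cinner e f *\<^sub>C v - (z * cinner e f) *\<^sub>C e"
    using f by (simp add: T_def 1 algebra_simps)
  also have "z *\<^sub>C f = (z * cinner e f) *\<^sub>C e + z *\<^sub>C Q f"
    by (metis Q_decomposition scaleC_add_right scaleC_scaleC)
  finally have "A (Q f) - z *\<^sub>C Q f = s *\<^sub>C e - cinner e f *\<^sub>C v"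
    by (simp add: algebra_simps)
  from resolvent_eqI[OF z this]
  have "Q f = s *\<^sub>C resolvent A z e - cinner e f *\<^sub>C resolvent A z v"
    by (simp add: clinear_diff[OF R] clinear_scaleC[OF R])
  then show thesis
    using 1 that by blast
qed

lemma resolvent_set_T:
  assumes z: "z \<in> resolvent_set A" and F: "feshbach z \<noteq> 0"
    and G: "cinner e (resolvent A z e) \<noteq> 0"
  shows "z \<in> resolvent_set T"
proof -
  let ?R = "resolvent A z"
  note R = clinear_resolvent[OF A z] and dec = resolvent_decoupled[OF z]
  \<comment> \<open>The ansatz \<open>c h *\<^sub>C e + y h\<close> solves \<open>T - z\<close> for
    \<open>h\<close>. The \<open>e\<close>-component of the equation determines \<open>c h\<close>,
    with \<open>feshbach z\<close> as denominator; the multiplier \<open>s h\<close> is chosen to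
    make \<open>y h\<close> orthogonal to \<open>e\<close>.\<close>
  define c where "c h = (cinner v (?R (Q h)) - cinner e h) * inverse (feshbach z)" for h
  define s where "s h = - cinner e (?R (Q h)) * inverse (cinner e (?R e))" for h
  define y where "y h = ?R (Q h - c h *\<^sub>C v + s h *\<^sub>C e)" for h
  define B where "B h = c h *\<^sub>C e + y h" for h
  show ?thesis
  proof (rule resolvent_setI[where B = B])
    fix f g assume fg: "T f - z *\<^sub>C f = T g - z *\<^sub>C g"
    define d where "d = f - g"
    have "T d = z *\<^sub>C d"
      using fg by (simp add: d_def clinear_diff[OF clinear_T]
          complex_vector.scale_right_diff_distrib algebra_simps)
    then obtain t where t: "Q d = t *\<^sub>C ?R e - cinner e d *\<^sub>C ?R v"
      and d: "cinner v d + a * cinner e d = z * cinner e d"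
      using T_eigenvector_form[OF z] by blast
    \<comment> \<open>Pairing with \<open>e\<close> removes the term in \<open>?R v\<close> and
      forces \<open>t = 0\<close>; pairing with \<open>v\<close> removes the term in
      \<open>?R e\<close> and leaves \<open>feshbach z\<close> as the factor of
      \<open>cinner e d\<close>.\<close>
    have "t * cinner e (?R e) = cinner e (Q d)"
      by (simp add: t cinner_diff_right cinner_scaleC_right dec)
    then have "t = 0"
      using G by (simp add: e_Q)
    have "cinner v d = - cinner e d * cinner v (?R v)"
      unfolding v_Q[of d, symmetric] by (simp add: t cinner_diff_right cinner_scaleC_right dec)
    then have "cinner e d * feshbach z = 0"
      using d by (simp add: feshbach_def algebra_simps)
    then have "cinner e d = 0"
      using F by simp
    then have "d = 0"
      using t \<open>t = 0\<close> Q_decomposition[of d] by simp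
    then show "f = g"
      by (simp add: d_def)
  next
    fix h
    have y': "y h = ?R (Q h) - c h *\<^sub>C ?R v + s h *\<^sub>C ?R e"
      by (simp add: y_def clinear_diff[OF R] clinear_add[OF R] clinear_scaleC[OF R])
    have e_y: "cinner e (y h) = 0"
      using G by (simp add: y' cinner_add_right cinner_diff_right cinner_scaleC_right dec s_def)
    have v_y: "cinner v (y h) = cinner v (?R (Q h)) - c h * cinner v (?R v)"
      by (simp add: y' cinner_add_right cinner_diff_right cinner_scaleC_right dec)
    have QB: "Q (B h) = y h" and eB: "cinner e (B h) = c h" and vB: "cinner v (B h) = cinner v (y h)"
      by (simp_all add: B_def Q_def cinner_add_right cinner_scaleC_right e e_y v_e)
    have "A (y h) = z *\<^sub>C y h + (Q h - c h *\<^sub>C v + s h *\<^sub>C e)"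
      using resolvent_works[OF z, of "Q h - c h *\<^sub>C v + s h *\<^sub>C e"]
      by (simp add: y_def algebra_simps)
    \<comment> \<open>Applying \<open>Q\<close> erases the multiplier term, since
      \<open>Q e = 0\<close>.\<close>
    moreover have "Q (y h) = y h" "Q (Q h) = Q h"
      by (simp_all add: Q_def e_y e_Q[unfolded Q_def])
    ultimately have QA: "Q (A (y h)) = z *\<^sub>C y h + Q h - c h *\<^sub>C v"
      by (simp add: clinear_add[OF clinear_Q] clinear_diff[OF clinear_Q]
          clinear_scaleC[OF clinear_Q] Q_e Q_v)
    have "c h * feshbach z = cinner v (?R (Q h)) - cinner e h"
      using F by (simp add: c_def)
    then have scalar: "cinner v (y h) + a * c h - z * c h = cinner e h"
      by (simp add: v_y feshbach_def algebra_simps)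
    have "T (B h) - z *\<^sub>C B h = Q h + (cinner v (y h) + a * c h - z * c h) *\<^sub>C e"
      by (simp add: T_def QB eB vB QA)
        (simp add: B_def scaleC_add_right scaleC_scaleC scaleC_add_left
          complex_vector.scale_left_diff_distrib algebra_simps)
    then show "T (B h) - z *\<^sub>C B h = h"
      by (simp add: scalar Q_def)
  next
    note R_bl = bounded_linear_resolvent[OF z]
    have scale: "bounded_linear (\<lambda>h. b h *\<^sub>C x)" if "bounded_linear b" for b and x :: 'a
      using bounded_linear_compose[OF bounded_linear_scaleC_left that] .
    have Q_bl: "bounded_linear Q"
      unfolding Q_def[abs_def]
      by (rule bounded_linear_sub[OF bounded_linear_ident scale[OF bounded_linear_cinner_right]])
    have RQ: "bounded_linear (\<lambda>h. cinner x (?R (Q h)))" for x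
      using bounded_linear_compose[OF bounded_linear_cinner_right
          bounded_linear_compose[OF R_bl Q_bl]] .
    have c: "bounded_linear c"
      unfolding c_def[abs_def]
      by (rule bounded_linear_mult_const[OF bounded_linear_sub[OF RQ bounded_linear_cinner_right]])
    have s: "bounded_linear s"
      unfolding s_def[abs_def]
      by (rule bounded_linear_mult_const[OF bounded_linear_minus[OF RQ]])
    have "bounded_linear (\<lambda>h. Q h - c h *\<^sub>C v + s h *\<^sub>C e)"
      by (rule bounded_linear_add[OF bounded_linear_sub[OF Q_bl scale[OF c]] scale[OF s]])
    then have "bounded_linear y"
      unfolding y_def[abs_def] by (rule bounded_linear_compose[OF R_bl])
    then show "bounded_linear B"
      unfolding B_def[abs_def] by (rule bounded_linear_add[OF scale[OF c]])
  qed
qed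

theorem discrete_eigenvalue_T:
  assumes lam: "complex_of_real lam \<in> resolvent_set A" and F: "feshbach (of_real lam) = 0"
  shows "discrete_eigenvalue T (of_real lam)"
proof -
  let ?l = "complex_of_real lam"
  let ?R = "resolvent A ?l"
  note R = clinear_resolvent[OF A lam] and dec = resolvent_decoupled[OF lam]
  \<comment> \<open>This is the general form of an eigenvector with \<open>e\<close>-component 1 and
    \<open>s = 0\<close>; its remaining scalar condition is exactly the vanishing of
    \<open>feshbach\<close>.\<close>
  define f where "f = e - ?R v"
  have e_f: "cinner e f = 1" and Q_f: "Q f = - ?R v" and v_f: "cinner v f = - cinner v (?R v)"
    by (simp_all add: f_def Q_def cinner_diff_right e dec v_e)
  have "A (?R v) = ?l *\<^sub>C ?R v + v"
    using resolvent_works[OF lam, of v] by (simp add: algebra_simps)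
  moreover have "Q (?R v) = ?R v"
    by (simp add: Q_def dec)
  ultimately have "Q (A (?R v)) = ?l *\<^sub>C ?R v + v"
    by (simp add: clinear_add[OF clinear_Q] clinear_scaleC[OF clinear_Q] Q_v)
  moreover have "cinner v f + a * cinner e f = ?l"
    using F by (simp add: v_f e_f feshbach_def algebra_simps)
  ultimately have T_f: "T f = ?l *\<^sub>C f"
    unfolding T_def
    by (simp add: Q_f e_f clinear_minus[OF A] clinear_minus[OF clinear_Q])
      (simp add: f_def complex_vector.scale_right_diff_distrib)
  have "f \<noteq> 0"
    using e_f by auto
  have "T 0 = 0"
    using clinear_diff[OF clinear_T, of 0 0] by simp
  have "?l \<notin> resolvent_set T"
  proof
    assume "?l \<in> resolvent_set T"
    from resolvent_eqI[OF this, of f 0] resolvent_eqI[OF this, of 0 0]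
    show False
      using T_f \<open>T 0 = 0\<close> \<open>f \<noteq> 0\<close> by simp
  qed
  moreover have "\<forall>\<^sub>F z in at ?l. z \<notin> spectrum T"
  proof -
    \<comment> \<open>Both nonvanishing conditions of \<open>resolvent_set_T\<close> hold on a
      punctured neighbourhood: the first is the case \<open>k = 1\<close> with vector
      \<open>v\<close>, the second the case \<open>k = 0\<close> with vector
      \<open>e\<close>.\<close>
    have "\<forall>\<^sub>F z in at ?l. feshbach z \<noteq> 0"
      using eventually_cinner_resolvent_nonzero[OF A symmetric lam, of 1 v "- a"]
      by (simp add: feshbach_def)
    moreover have "\<forall>\<^sub>F z in at ?l. cinner e (resolvent A z e) \<noteq> 0"
      using eventually_cinner_resolvent_nonzero[OF A symmetric lam, of 0 e 0] e_nonzero by simp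
    ultimately show ?thesis
      using eventually_resolvent_set[OF A lam]
      by eventually_elim (simp add: spectrum_def resolvent_set_T)
  qed
  moreover have "f \<in> eigenspace T ?l"
    using T_f by (simp add: eigenspace_def)
  \<comment> \<open>\<open>cinner e (?R e)\<close> may vanish at \<open>?l\<close> itself, and then
    \<open>?R e\<close> is a further eigenvector; hence it appears among the spanning
    vectors.\<close>
  moreover have "eigenspace T ?l \<subseteq> complex_vector.span {e, ?R e, ?R v}"
  proof
    fix g assume "g \<in> eigenspace T ?l"
    then obtain s where "Q g = s *\<^sub>C ?R e - cinner e g *\<^sub>C ?R v"
      using T_eigenvector_form[OF lam] by (auto simp: eigenspace_def)
    then have "g = cinner e g *\<^sub>C e + (s *\<^sub>C ?R e - cinner e g *\<^sub>C ?R v)"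
      using Q_decomposition[of g] by simp
    also have "\<dots> \<in> complex_vector.span {e, ?R e, ?R v}"
      by (intro complex_vector.span_add complex_vector.span_diff complex_vector.span_scale
          complex_vector.span_base) auto
    finally show "g \<in> complex_vector.span {e, ?R e, ?R v}" .
  qed
  ultimately show ?thesis
    unfolding discrete_eigenvalue_def isolated_in_altdef spectrum_def
    using \<open>f \<noteq> 0\<close> by (auto intro!: exI[of _ "{e, ?R e, ?R v}"])
qed

end

section \<open>Square-summable functions on the lattice\<close>

lemma norm_ell2_power2:
  "(norm f)\<^sup>2 = (\<Sum>\<^sub>\<infinity>x. (norm (ell2_apply f x))\<^sup>2)"
proof -
  have "(norm f)\<^sup>2 = Re (\<Sum>\<^sub>\<infinity>x. cinner (ell2_apply f x) (ell2_apply f x))"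
    by (simp add: power2_norm_eq_inner inner_eq_Re_cinner cinner_ell2.rep_eq)
  also have "\<dots> = (\<Sum>\<^sub>\<infinity>x. Re (cinner (ell2_apply f x) (ell2_apply f x)))"
    by (simp add: infsum_Re square_summable_cinner square_summable_ell2_apply)
  finally show ?thesis
    by (simp add: cinner_self)
qed

lemma ell2_apply_add: "ell2_apply (f + g) x = ell2_apply f x + ell2_apply g x"
  and ell2_apply_scaleC: "ell2_apply (c *\<^sub>C f) x = c *\<^sub>C ell2_apply f x"
  and ell2_apply_zero: "ell2_apply 0 x = 0"
  by (simp_all add: plus_ell2.rep_eq scaleC_ell2.rep_eq zero_ell2.rep_eq)

lemma ell2_apply_diff: "ell2_apply (f - g) x = ell2_apply f x - ell2_apply g x"
  using ell2_apply_add[of "f - g" g x] by simp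

lemma ell2_apply_sum: "ell2_apply (sum F A) x = (\<Sum>i\<in>A. ell2_apply (F i) x)"
  by (induction A rule: infinite_finite_induct) (auto simp: ell2_apply_add ell2_apply_zero)

lemma sum_norm_ell2_apply_le:
  assumes "finite F"
  shows "(\<Sum>x\<in>F. (norm (ell2_apply f x))\<^sup>2) \<le> (norm f)\<^sup>2"
  unfolding norm_ell2_power2
  using square_summable_ell2_apply[of f] assms
  by (intro finite_sum_le_infsum) (auto simp: square_summable_def)

lemma norm_ell2_apply_le: "norm (ell2_apply f x) \<le> norm f"
  using sum_norm_ell2_apply_le[of "{x}" f] by (simp add: power2_le_iff_abs_le)

text \<open>Supplies the completeness behind the fixed-point argument for resolvents. The candidate
  limit is pointwise; estimates over finite sets of sites survive the limit and control the full
  norm.\<close>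

instance ell2 :: (type, "{complex_inner, complete_space}") complete_space
proof
  fix X :: "nat \<Rightarrow> ('a, 'b) ell2" assume X: "Cauchy X"
  have "Cauchy (\<lambda>n. ell2_apply (X n) x)" for x
  proof (rule CauchyI)
    fix r :: real assume "r > 0"
    then obtain N where "\<forall>m\<ge>N. \<forall>n\<ge>N. norm (X m - X n) < r"
      using CauchyD[OF X] by blast
    then show "\<exists>M. \<forall>m\<ge>M. \<forall>n\<ge>M. norm (ell2_apply (X m) x - ell2_apply (X n) x) < r"
      by (metis ell2_apply_diff norm_ell2_apply_le order_le_less_trans)
  qed
  then have "\<forall>x. \<exists>y. (\<lambda>n. ell2_apply (X n) x) \<longlonglongrightarrow> y"
    using Cauchy_convergent convergent_def by blast
  then obtain g where g: "\<And>x. (\<lambda>n. ell2_apply (X n) x) \<longlonglongrightarrow> g x"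
    by metis
  have bound: "\<exists>N. \<forall>n\<ge>N. \<forall>F. finite F \<longrightarrow>
      (\<Sum>x\<in>F. (norm (ell2_apply (X n) x - g x))\<^sup>2) \<le> r\<^sup>2" if "r > 0" for r
  proof -
    obtain N where N: "\<And>m n. m \<ge> N \<Longrightarrow> n \<ge> N \<Longrightarrow> norm (X m - X n) < r"
      using CauchyD[OF X \<open>r > 0\<close>] by blast
    have "(\<Sum>x\<in>F. (norm (ell2_apply (X n) x - g x))\<^sup>2) \<le> r\<^sup>2" if "n \<ge> N" "finite F" for n F
    \<comment> \<open>With \<open>n\<close> and the finite set \<open>F\<close> fixed,
      \<open>m\<close> tends to infinity in the Cauchy estimate.\<close>
    proof (rule tendsto_upperbound)
      show "(\<lambda>m. \<Sum>x\<in>F. (norm (ell2_apply (X n) x - ell2_apply (X m) x))\<^sup>2)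
          \<longlonglongrightarrow> (\<Sum>x\<in>F. (norm (ell2_apply (X n) x - g x))\<^sup>2)"
        by (intro tendsto_intros g)
      show "\<forall>\<^sub>F m in sequentially. (\<Sum>x\<in>F. (norm (ell2_apply (X n) x - ell2_apply (X m) x))\<^sup>2) \<le> r\<^sup>2"
        using eventually_ge_at_top[of N]
      proof eventually_elim
        case (elim m)
        have "(\<Sum>x\<in>F. (norm (ell2_apply (X n) x - ell2_apply (X m) x))\<^sup>2) \<le> (norm (X n - X m))\<^sup>2"
          using sum_norm_ell2_apply_le[OF \<open>finite F\<close>, of "X n - X m"]
          by (simp add: ell2_apply_diff)
        also have "\<dots> \<le> r\<^sup>2"
          using N[OF \<open>n \<ge> N\<close> elim] by (intro power_mono) auto
        finally show ?case .
      qed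
    qed simp
    then show ?thesis
      by blast
  qed
  have ss: "square_summable h"
    if "\<And>F. finite F \<Longrightarrow> (\<Sum>x\<in>F. (norm (h x))\<^sup>2) \<le> C" for h :: "'a \<Rightarrow> 'b" and C
    unfolding square_summable_def
  proof (rule nonneg_bdd_above_summable_on)
    show "bdd_above (sum (\<lambda>x. (norm (h x))\<^sup>2) ` {F. F \<subseteq> UNIV \<and> finite F})"
      using that by (intro bdd_aboveI2) auto
  qed simp
  obtain N where "\<And>F. finite F \<Longrightarrow> (\<Sum>x\<in>F. (norm (ell2_apply (X N) x - g x))\<^sup>2) \<le> 1"
    using bound[of 1] by auto
  then have "square_summable (\<lambda>x. ell2_apply (X N) x - g x)"
    by (rule ss)
  then have "square_summable (\<lambda>x. - (ell2_apply (X N) x - g x))"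
    by (rule square_summable_le[where C = 1]) (simp add: norm_minus_commute)
  from square_summable_add[OF square_summable_ell2_apply[of "X N"] this]
  have "square_summable g"
    by simp
  then have G: "ell2_apply (Abs_ell2 g) = g"
    by (simp add: Abs_ell2_inverse)
  have "X \<longlonglongrightarrow> Abs_ell2 g"
  proof (rule LIMSEQ_I)
    fix r :: real assume "r > 0"
    \<comment> \<open>The supremum over finite sets gives only a non-strict bound;
      \<open>r / 2\<close> makes the final one strict.\<close>
    then obtain N where N: "\<And>n F. n \<ge> N \<Longrightarrow> finite F \<Longrightarrow>
        (\<Sum>x\<in>F. (norm (ell2_apply (X n) x - g x))\<^sup>2) \<le> (r / 2)\<^sup>2"
      using bound[of "r / 2"] by auto
    have "norm (X n - Abs_ell2 g) < r" if "n \<ge> N" for n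
    proof -
      have "(norm (X n - Abs_ell2 g))\<^sup>2 \<le> (r / 2)\<^sup>2"
        unfolding norm_ell2_power2
        using square_summable_ell2_apply[of "X n - Abs_ell2 g"] N[OF that]
        by (intro infsum_le_finite_sums) (simp_all add: square_summable_def ell2_apply_diff G)
      then have "norm (X n - Abs_ell2 g) \<le> r / 2"
        using \<open>r > 0\<close> by (simp add: power2_le_iff_abs_le)
      then show ?thesis
        using \<open>r > 0\<close> by simp
    qed
    then show "\<exists>N. \<forall>n\<ge>N. norm (X n - Abs_ell2 g) < r"
      by blast
  qed
  then show "convergent X"
    by (rule convergentI)
qed

section \<open>Indicators, characters and the twisted reflection\<close>

lemma ell2_apply_indicator: "ell2_apply (ell2_indicator a) x = (if x = a then 1 else 0)"
  by (simp add: ell2_indicator.rep_eq)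

lemma cinner_ell2_indicator: "cinner (ell2_indicator a) f = ell2_apply f a"
proof -
  have "cinner (ell2_indicator a) f
      = (\<Sum>\<^sub>\<infinity>x. cinner (ell2_apply (ell2_indicator a) x) (ell2_apply f x))"
    by (rule cinner_ell2.rep_eq)
  also have "\<dots> = (\<Sum>\<^sub>\<infinity>x\<in>{a}. cinner (ell2_apply (ell2_indicator a) x) (ell2_apply f x))"
    by (rule infsum_cong_neutral) (auto simp: ell2_apply_indicator)
  finally show ?thesis
    by (simp add: ell2_apply_indicator cinner_complex_def)
qed

definition lattice_character :: "('d \<Rightarrow> real) \<Rightarrow> 'd :: finite lattice \<Rightarrow> complex"
  where "lattice_character \<theta> x = cis (\<Sum>j\<in>UNIV. \<theta> j * of_int (x $ j))"

lemma lattice_character_add: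
  "lattice_character \<theta> (x + y) = lattice_character \<theta> x * lattice_character \<theta> y"
  by (simp add: lattice_character_def cis_mult distrib_left sum.distrib)

lemma lattice_character_uminus: "lattice_character \<theta> (- x) = cnj (lattice_character \<theta> x)"
  by (simp add: lattice_character_def cis_cnj sum_negf)

lemma lattice_character_diff:
  "lattice_character \<theta> (x - y) = lattice_character \<theta> x * cnj (lattice_character \<theta> y)"
  using lattice_character_add[of \<theta> x "- y"] by (simp add: lattice_character_uminus)

lemma lattice_character_zero: "lattice_character \<theta> 0 = 1"
  by (simp add: lattice_character_def)

lemma lattice_character_unit_step: "lattice_character \<theta> (unit_step j) = cis (\<theta> j)"
  by (simp add: lattice_character_def axis_def if_distrib[of "\<lambda>k. _ * of_int k"] cong: if_cong)

lemma cmod_lattice_character: "cmod (lattice_character \<theta> x) = 1"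
  by (simp add: lattice_character_def)

lift_definition reflection :: "('d \<Rightarrow> real) \<Rightarrow> 'd :: finite scalar_space \<Rightarrow> 'd scalar_space"
  is "\<lambda>\<theta> f x. lattice_character \<theta> x * f (- x)"
proof -
  fix \<theta> and f :: "'d lattice \<Rightarrow> complex"
  assume "square_summable f"
  then have "square_summable (\<lambda>x. f (- x))"
    by (rule square_summable_bij) (rule bij_uminus)
  then show "square_summable (\<lambda>x. lattice_character \<theta> x * f (- x))"
    by (rule square_summable_le[where C = 1]) (simp add: norm_mult cmod_lattice_character)
qed

lemma clinear_reflection: "clinear (reflection \<theta>)"
  unfolding clinear_def
  by (auto intro!: ell2_eqI simp: reflection.rep_eq ell2_apply_add ell2_apply_scaleC
      scaleC_complex_def algebra_simps)

text \<open>The character is unimodular and inversion permutes the lattice.\<close>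

lemma cinner_reflection: "cinner (reflection \<theta> f) (reflection \<theta> g) = cinner f g"
proof -
  have unimodular: "cnj (lattice_character \<theta> x) * lattice_character \<theta> x = 1" for x
    using complex_norm_square[of "lattice_character \<theta> x"]
    by (simp add: cmod_lattice_character mult.commute)
  have "cinner (reflection \<theta> f) (reflection \<theta> g)
      = (\<Sum>\<^sub>\<infinity>x. (cnj (lattice_character \<theta> x) * lattice_character \<theta> x) *
          (cnj (ell2_apply f (- x)) * ell2_apply g (- x)))"
    by (simp add: cinner_ell2.rep_eq reflection.rep_eq cinner_complex_def mult_ac)
  also have "\<dots> = (\<Sum>\<^sub>\<infinity>x. cnj (ell2_apply f (- x)) * ell2_apply g (- x))"
    by (simp only: unimodular mult_1_left)
  also have "\<dots> = (\<Sum>\<^sub>\<infinity>x. cnj (ell2_apply f x) * ell2_apply g x)"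
    by (rule infsum_reindex_bij_betw) (rule bij_uminus)
  finally show ?thesis
    by (simp add: cinner_ell2.rep_eq cinner_complex_def)
qed

lemma reflection_indicator:
  "reflection \<theta> (ell2_indicator a) = cnj (lattice_character \<theta> a) *\<^sub>C ell2_indicator (- a)"
  by (rule ell2_eqI)
    (auto simp: reflection.rep_eq ell2_apply_scaleC ell2_apply_indicator scaleC_complex_def
      lattice_character_uminus minus_equation_iff)

section \<open>Reflection symmetry of \<open>T0\<close> and oddness of
  \<open>phi_vec\<close>\<close>

lemma T0_apply:
  "ell2_apply (T0 p q \<Phi> f) x = a_coeff \<Phi> p * ell2_apply f x +
    (\<Sum>j\<in>UNIV. alpha q \<Phi> j * ell2_apply f (x + unit_step j) +
      cnj (alpha q \<Phi> j) * ell2_apply f (x - unit_step j))"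
  by (simp add: T0_def cadjoint_translation ell2_apply_add ell2_apply_sum ell2_apply_scaleC
      scaleC_complex_def translation.rep_eq translation_adj.rep_eq)

lemma clinear_T0: "clinear (T0 p q \<Phi>)"
  unfolding clinear_def
  by (auto intro!: ell2_eqI simp: T0_apply ell2_apply_add ell2_apply_scaleC
      scaleC_complex_def sum_distrib_left sum.distrib algebra_simps)

text \<open>Inversion exchanges each translation with its adjoint, and the character adds the factor
  \<open>cis (\<theta> j)\<close> or its conjugate; by assumption these factors exchange
  \<open>alpha q \<Phi> j\<close> with its conjugate.\<close>

lemma reflection_T0:
  assumes "\<And>j. alpha q \<Phi> j * cis (\<theta> j) = cnj (alpha q \<Phi> j)"
  shows "reflection \<theta> (T0 p q \<Phi> f) = T0 p q \<Phi> (reflection \<theta> f)"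
proof (rule ell2_eqI)
  fix x
  let ?c = "lattice_character \<theta> x"
  have 1: "alpha q \<Phi> j * lattice_character \<theta> (x + unit_step j) = cnj (alpha q \<Phi> j) * ?c" for j
    using assms[of j] by (simp add: lattice_character_add lattice_character_unit_step mult_ac)
  have 2: "cnj (alpha q \<Phi> j) * lattice_character \<theta> (x - unit_step j) = alpha q \<Phi> j * ?c" for j
    using arg_cong[OF assms[of j], of cnj]
    by (simp add: lattice_character_diff lattice_character_unit_step mult_ac)
  have "ell2_apply (T0 p q \<Phi> (reflection \<theta> f)) x = a_coeff \<Phi> p * (?c * ell2_apply f (- x)) +
    (\<Sum>j\<in>UNIV. (alpha q \<Phi> j * lattice_character \<theta> (x + unit_step j)) *
        ell2_apply f (- x - unit_step j) +
      (cnj (alpha q \<Phi> j) * lattice_character \<theta> (x - unit_step j)) *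
        ell2_apply f (- x + unit_step j))"
    by (simp add: T0_apply reflection.rep_eq mult.assoc algebra_simps)
  also have "\<dots> = ?c * ell2_apply (T0 p q \<Phi> f) (- x)"
    unfolding 1 2 by (simp add: T0_apply sum_distrib_left algebra_simps)
  finally show "ell2_apply (reflection \<theta> (T0 p q \<Phi> f)) x = ell2_apply (T0 p q \<Phi> (reflection \<theta> f)) x"
    by (simp add: reflection.rep_eq)
qed

lemma reflection_phi_vec:
  assumes \<theta>: "\<And>j. alpha q \<Phi> j * cis (\<theta> j) = cnj (alpha q \<Phi> j)"
    and orth: "\<And>j. \<Phi> $ j $ 1 * \<Omega> $ j $ 2 + \<Phi> $ j $ 2 * \<Omega> $ j $ 1 = 0"
  shows "reflection \<theta> (phi_vec q \<Phi> \<Omega>) = - phi_vec q \<Phi> \<Omega>"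
proof -
  define b c where "b j = q $ j * \<Omega> $ j $ 2 * cnj (\<Phi> $ j $ 1)"
    and "c j = cnj (q $ j) * \<Omega> $ j $ 1 * cnj (\<Phi> $ j $ 2)" for j
  have bc: "b j * cis (\<theta> j) = - c j" for j
  \<comment> \<open>If \<open>alpha\<close> vanishes, then \<open>q $ j\<close> or an entry of
    \<open>\<Phi> $ j\<close> is zero, and \<open>orth\<close> forces \<open>b j = c j = 0\<close>
    whatever the phase.\<close>
  proof (cases "alpha q \<Phi> j = 0")
    case True
    then show ?thesis
      using orth[of j] by (auto simp: alpha_def b_def c_def)
  next
    case False
    have o: "\<Phi> $ j $ 1 * \<Omega> $ j $ 2 = - (\<Phi> $ j $ 2 * \<Omega> $ j $ 1)"
      using orth[of j] by (simp add: eq_neg_iff_add_eq_0)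
    \<comment> \<open>Multiplying by the nonzero \<open>\<Phi> $ j $ 2\<close> makes
      \<open>alpha\<close> appear, so that the assumption on \<open>\<theta>\<close> and then
      \<open>orth\<close> apply.\<close>
    have "(b j * cis (\<theta> j)) * \<Phi> $ j $ 2 = \<Omega> $ j $ 2 * (alpha q \<Phi> j * cis (\<theta> j))"
      by (simp add: b_def alpha_def mult_ac)
    also have "\<dots> = (cnj (q $ j) * cnj (\<Phi> $ j $ 2)) * (\<Phi> $ j $ 1 * \<Omega> $ j $ 2)"
      unfolding \<theta> by (simp add: alpha_def mult_ac)
    also have "\<dots> = - c j * \<Phi> $ j $ 2"
      unfolding o by (simp add: c_def mult_ac)
    finally have "(b j * cis (\<theta> j)) * \<Phi> $ j $ 2 = - c j * \<Phi> $ j $ 2" .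
    moreover have "\<Phi> $ j $ 2 \<noteq> 0"
      using False by (simp add: alpha_def)
    ultimately show ?thesis
      using mult_right_cancel by blast
  qed
  have cb: "c j * cnj (cis (\<theta> j)) = - b j" for j
  proof -
    have "c j * cnj (cis (\<theta> j)) = - (b j * (cis (\<theta> j) * cnj (cis (\<theta> j))))"
      using bc[of j] by (simp add: mult.assoc[symmetric])
    then show ?thesis
      by (simp add: cis_cnj cis_mult)
  qed
  note V = clinear_reflection[of \<theta>]
  have V_sum: "reflection \<theta> (sum F A) = (\<Sum>i\<in>A. reflection \<theta> (F i))" for F and A :: "'a set"
    using clinear_diff[OF V, of 0 0]
    by (induction A rule: infinite_finite_induct) (auto simp: clinear_add[OF V])
  have "reflection \<theta> (b j *\<^sub>C ell2_indicator (- unit_step j) + c j *\<^sub>C ell2_indicator (unit_step j))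
      = - (b j *\<^sub>C ell2_indicator (- unit_step j) + c j *\<^sub>C ell2_indicator (unit_step j))" for j
    by (simp add: clinear_add[OF V] clinear_scaleC[OF V] reflection_indicator
        lattice_character_uminus lattice_character_unit_step scaleC_scaleC bc cb)
  then show ?thesis
    by (simp only: phi_vec_def V_sum sum_negf flip: b_def c_def)
qed

section \<open>The discriminant operator as a perturbation\<close>

lemma a_coeff_eq:
  "a_coeff \<Omega> p = (\<Sum>j\<in>UNIV. complex_of_real (p $ j) *
    (cnj (\<Omega> $ j $ 1) * \<Omega> $ j $ 1 - cnj (\<Omega> $ j $ 2) * \<Omega> $ j $ 2))"
  by (simp add: a_coeff_def cinner_vec_def cinner_complex_def sum_2 sigma3_def
      matrix_vector_mult_def)

text \<open>The \<open>p\<close> part of the shift stays on the site and gives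
  \<open>a_coeff\<close> of the local vector; the \<open>q\<close> part pairs the conjugated vector
  at \<open>x\<close> with the vector at a neighbour.\<close>

lemma discriminant_apply:
  "ell2_apply (discriminant p q \<Phi> \<Omega> f) x = a_coeff (chi_field \<Phi> \<Omega> x) p * ell2_apply f x +
    (\<Sum>j\<in>UNIV.
      q $ j * cnj (chi_field \<Phi> \<Omega> x $ j $ 1) * chi_field \<Phi> \<Omega> (x + unit_step j) $ j $ 2 *
        ell2_apply f (x + unit_step j) +
      cnj (q $ j) * cnj (chi_field \<Phi> \<Omega> x $ j $ 2) * chi_field \<Phi> \<Omega> (x - unit_step j) $ j $ 1 *
        ell2_apply f (x - unit_step j))"
  by (simp add: discriminant_def cadjoint_d_chi d_chi.rep_eq d_chi_adj.rep_eq shift_operator_def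
      direct_sum.rep_eq shift_component.rep_eq component.rep_eq a_coeff_eq sum_distrib_right
      cinner_vec_def cinner_complex_def sum_2 scaleC_vec_def scaleC_complex_def
      flip: sum.distrib)
    (simp add: algebra_simps)

lemma phi_vec_apply:
  "ell2_apply (phi_vec q \<Phi> \<Omega>) x = (\<Sum>j\<in>UNIV.
    (if x = - unit_step j then q $ j * \<Omega> $ j $ 2 * cnj (\<Phi> $ j $ 1) else 0) +
    (if x = unit_step j then cnj (q $ j) * \<Omega> $ j $ 1 * cnj (\<Phi> $ j $ 2) else 0))"
  unfolding phi_vec_def ell2_apply_sum
  by (rule sum.cong) (auto simp: ell2_apply_add ell2_apply_scaleC ell2_apply_indicator
      scaleC_complex_def)

lemma cinner_phi_vec:
  "cinner (phi_vec q \<Phi> \<Omega>) f = (\<Sum>j\<in>UNIV.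
    cnj (q $ j * \<Omega> $ j $ 2 * cnj (\<Phi> $ j $ 1)) * ell2_apply f (- unit_step j) +
    cnj (cnj (q $ j) * \<Omega> $ j $ 1 * cnj (\<Phi> $ j $ 2)) * ell2_apply f (unit_step j))"
  by (simp add: phi_vec_def cinner_sum_left cinner_add_left cinner_scaleC_left
      cinner_ell2_indicator)

lemma unit_step_nonzero: "unit_step j \<noteq> 0"
  by (simp add: axis_eq_0_iff)

lemma phi_vec_zero: "ell2_apply (phi_vec q \<Phi> \<Omega>) 0 = 0"
  by (simp add: phi_vec_apply unit_step_nonzero unit_step_nonzero[symmetric])

lemma reflected_perturbation_T0:
  assumes "\<And>j. alpha q \<Phi> j * cis (\<theta> j) = cnj (alpha q \<Phi> j)"
    and "\<And>j. \<Phi> $ j $ 1 * \<Omega> $ j $ 2 + \<Phi> $ j $ 2 * \<Omega> $ j $ 1 = 0"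
  shows "reflected_perturbation (T0 p q \<Phi>) (reflection \<theta>) (ell2_indicator 0) (phi_vec q \<Phi> \<Omega>)"
proof
  show "cinner (ell2_indicator 0) (ell2_indicator 0 :: 'a scalar_space) = 1"
    by (simp add: cinner_ell2_indicator ell2_apply_indicator)
qed (simp_all add: clinear_T0 T0_symmetric cinner_ell2_indicator phi_vec_zero clinear_reflection
    reflection_T0 assms cinner_reflection reflection_indicator lattice_character_zero
    reflection_phi_vec)

text \<open>\<open>chi_field\<close> differs from \<open>\<Phi>\<close> only at the origin, so the
  matrix of the discriminant differs from that of \<open>T0\<close> only in the row and column of
  the origin, which \<open>phi_vec\<close> and \<open>a_coeff \<Omega> p\<close> describe.\<close>

lemma discriminant_eq_perturbation:
  assumes "reflected_perturbation (T0 p q \<Phi>) V (ell2_indicator 0) (phi_vec q \<Phi> \<Omega>)"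
  shows "discriminant p q \<Phi> \<Omega> =
    reflected_perturbation.T (T0 p q \<Phi>) (ell2_indicator 0) (phi_vec q \<Phi> \<Omega>) (a_coeff \<Omega> p)"
proof (intro ext ell2_eqI)
  interpret reflected_perturbation "T0 p q \<Phi>" V "ell2_indicator 0" "phi_vec q \<Phi> \<Omega>" "a_coeff \<Omega> p"
    by (rule assms)
  fix f x
  have Q: "ell2_apply (Q h) y = (if y = 0 then 0 else ell2_apply h y)" for h y
    by (simp add: Q_def ell2_apply_diff ell2_apply_scaleC cinner_ell2_indicator
        ell2_apply_indicator scaleC_complex_def)
  have T: "ell2_apply (T f) y = (if y = 0 then cinner (phi_vec q \<Phi> \<Omega>) f + a_coeff \<Omega> p * ell2_apply f 0
      else ell2_apply (T0 p q \<Phi> (Q f)) y + ell2_apply f 0 * ell2_apply (phi_vec q \<Phi> \<Omega>) y)" for y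
    by (simp add: T_def ell2_apply_add ell2_apply_scaleC Q cinner_ell2_indicator
        ell2_apply_indicator scaleC_complex_def phi_vec_zero)
  show "ell2_apply (discriminant p q \<Phi> \<Omega> f) x = ell2_apply (T f) x"
  proof (cases "x = 0")
    case True
    then show ?thesis
      by (simp add: T discriminant_apply cinner_phi_vec chi_field_def unit_step_nonzero)
        (simp add: algebra_simps)
  next
    case False
    \<comment> \<open>Rewrites the case distinctions of \<open>phi_vec\<close> as the question
      whether a neighbour of \<open>x\<close> is the origin, as in \<open>chi_field\<close> and
      \<open>Q\<close>.\<close>
    have *: "x = - unit_step j \<longleftrightarrow> x + unit_step j = 0" "x = unit_step j \<longleftrightarrow> x - unit_step j = 0" for j
      by (simp_all add: eq_neg_iff_add_eq_0)
    show ?thesis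
      unfolding T discriminant_apply T0_apply phi_vec_apply * Q
      using False
      by (simp add: chi_field_def alpha_def sum_distrib_left add.assoc flip: sum.distrib)
        (rule sum.cong, auto simp: algebra_simps)
  qed
qed

section \<open>Choice of the phases and conclusion\<close>

theorem theorem3p4:
  fixes \<Phi> \<Omega> :: "complex ^ 2 ^ 'd :: finite"
    and p :: "real ^ 'd" and q :: "complex ^ 'd"
    and l :: 'd and lam :: real
  assumes "norm \<Phi> = 1" and "norm \<Omega> = 1"
    and a: "\<And>j. scalar_product (\<Phi> $ j) (sigma1 *v \<Omega> $ j) = 0"
    and b: "cinner (\<Phi> $ l) (sigma_plus *v \<Omega> $ l) \<noteq> 0"
    and "(p, q) \<in> param_set_at l"
    and "lam \<in> {-1..1}"
    and "complex_of_real lam \<notin> spectrum (T0 p q \<Phi>) \<union> {a_coeff \<Omega> p}"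
    and "frakf p q \<Phi> \<Omega> lam = 0"
  shows "discrete_eigenvalue (discriminant p q \<Phi> \<Omega>) (complex_of_real lam)"
proof -
  have orth: "\<Phi> $ j $ 1 * \<Omega> $ j $ 2 + \<Phi> $ j $ 2 * \<Omega> $ j $ 1 = 0" for j
    using a[of j]
    by (simp add: scalar_product_def sigma1_def matrix_vector_mult_def sum_2)
  \<comment> \<open>Subtracting twice the argument negates the phase of \<open>alpha\<close>, which
    is conjugation.\<close>
  define \<theta> where "\<theta> j = - 2 * Arg (alpha q \<Phi> j)" for j
  have \<theta>: "alpha q \<Phi> j * cis (\<theta> j) = cnj (alpha q \<Phi> j)" for j
  proof -
    have z: "alpha q \<Phi> j = complex_of_real (cmod (alpha q \<Phi> j)) * cis (Arg (alpha q \<Phi> j))"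
      by (metis rcis_cmod_Arg rcis_def)
    show ?thesis
      by (subst (1 2) z) (simp add: \<theta>_def mult.assoc cis_mult cis_cnj)
  qed
  interpret reflected_perturbation "T0 p q \<Phi>" "reflection \<theta>" "ell2_indicator 0" "phi_vec q \<Phi> \<Omega>"
    "a_coeff \<Omega> p"
    using \<theta> orth by (rule reflected_perturbation_T0)
  have "discrete_eigenvalue T (complex_of_real lam)"
    using assms(7,8) by (intro discrete_eigenvalue_T) (simp_all add: spectrum_def feshbach_def frakf_def)
  then show ?thesis
    by (simp add: discriminant_eq_perturbation[OF reflected_perturbation_axioms])
qed

end
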